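(* Let $F=f+h:\mathbb{R}^n\to\mathbb{R}$, where $f:\mathbb{R}^n\to\mathbb{R}$ is $L$-smooth and $h:\mathbb{R}^n\to\mathbb{R}$ is convex. Then for every initial point $\mathbf{x}_0\in\mathbb{R}^n$ the proximal flow $$\dot{\mathbf{x}}(t)=\lim_{\beta\to0^+}\frac{\mathbf{prox}_{\beta F}(\mathbf{x}(t))-\mathbf{x}(t)}{\beta},\qquad \mathbf{x}(0)=\mathbf{x}_0,$$ admits a solution $\mathbf{x}(t)$, $t\ge0$, and this solution is unique.
   Context: All norms are Euclidean norms. A function $f$ is $L$-smooth if it is differentiable everywhere and $\|\nabla f(\mathbf{x})-\nabla f(\mathbf{y})\|\le L\|\mathbf{x}-\mathbf{y}\|$ for all $\mathbf{x},\mathbf{y}$. For $\beta>0$, $\mathbf{prox}_{\beta F}(\mathbf{x})=\operatorname{argmin}_{\mathbf{z}} F(\mathbf{z})+\frac{1}{2\beta}\|\mathbf{x}-\mathbf{z}\|^2$, which for the functions considered is single-valued for all sufficiently small $\beta>0$. A solution is a (locally) absolutely continuous function $\mathbf{x}:[0,\infty)\to\mathbb{R}^n$ with the prescribed initial value that satisfies the differential equation for almost every $t\ge0$ (the right-hand side need not be continuous in $\mathbf{x}$). *)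

theory Defs
  imports "HOL-Analysis.Analysis"
begin

definition L_smooth :: "real \<Rightarrow> ('a::real_inner \<Rightarrow> real) \<Rightarrow> bool" where
  "L_smooth L f \<longleftrightarrow>
     (\<exists>grad. (\<forall>x. GDERIV f x :> grad x) \<and>
             (\<forall>x y. norm (grad x - grad y) \<le> L * norm (x - y)))"

definition is_prox :: "real \<Rightarrow> ('a::real_inner \<Rightarrow> real) \<Rightarrow> 'a \<Rightarrow> 'a \<Rightarrow> bool" where
  "is_prox \<beta> F x p \<longleftrightarrow>
     is_arg_min (\<lambda>z. F z + 1 / (2 * \<beta>) * (norm (x - z))\<^sup>2) (\<lambda>_. True) p"

text \<open>Only meaningful when the minimizer exists and is unique.\<close>

definition prox :: "real \<Rightarrow> ('a::real_inner \<Rightarrow> real) \<Rightarrow> 'a \<Rightarrow> 'a" where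
  "prox \<beta> F x = (THE p. is_prox \<beta> F x p)"

text \<open>The limit defining the right-hand side of the proximal flow exists at \<open>x\<close> and equals \<open>v\<close>.
  The first conjunct excludes limits formed from the arbitrary values that \<open>prox\<close> takes where
  the proximal map is not single-valued.\<close>

definition has_prox_velocity :: "('a::real_inner \<Rightarrow> real) \<Rightarrow> 'a \<Rightarrow> 'a \<Rightarrow> bool" where
  "has_prox_velocity F x v \<longleftrightarrow>
     (\<forall>\<^sub>F \<beta> in at_right 0. \<exists>!p. is_prox \<beta> F x p) \<and>
     ((\<lambda>\<beta>. (prox \<beta> F x - x) /\<^sub>R \<beta>) \<longlongrightarrow> v) (at_right 0)"

text \<open>The \<open>\<epsilon>\<close>-\<open>\<delta>\<close> definition of absolute continuity. A division \<open>\<D>\<close> is a finite family of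
  compact intervals with pairwise disjoint interiors; it need not cover \<open>S\<close>.\<close>

definition absolutely_continuous_on :: "real set \<Rightarrow> (real \<Rightarrow> 'a::real_normed_vector) \<Rightarrow> bool" where
  "absolutely_continuous_on S x \<longleftrightarrow>
     (\<forall>\<epsilon>>0. \<exists>\<delta>>0. \<forall>\<D>. \<D> division_of \<Union>\<D> \<and> \<Union>\<D> \<subseteq> S \<and> (\<Sum>K\<in>\<D>. Sup K - Inf K) < \<delta> \<longrightarrow>
        (\<Sum>K\<in>\<D>. norm (x (Sup K) - x (Inf K))) < \<epsilon>)"

text \<open>Trajectories are total functions on the reals, but only their values on \<open>[0, \<infinity>)\<close> matter.\<close>

definition prox_flow_solution ::
    "('a::euclidean_space \<Rightarrow> real) \<Rightarrow> 'a \<Rightarrow> (real \<Rightarrow> 'a) \<Rightarrow> bool" where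
  "prox_flow_solution F x0 x \<longleftrightarrow>
     x 0 = x0 \<and>
     (\<forall>T\<ge>0. absolutely_continuous_on {0..T} x) \<and>
     (AE t in lebesgue_on {0..}.
        \<exists>v. (x has_vector_derivative v) (at t within {0..}) \<and> has_prox_velocity F (x t) v)"

end

theory Submission
  imports Defs "HOL-Complex_Analysis.Great_Picard" "HOL-Real_Asymp.Real_Asymp"
begin

text \<open>Since \<open>f\<close> is \<open>L\<close>-smooth and \<open>h\<close> is convex, \<open>F\<close> plus \<open>L / 2\<close> times the squared norm is convex. Such a
function has, at every point, a nonempty closed convex set of subgradients (with a quadratic
error term), and this set-valued map is monotone up to the constant \<open>L\<close>. A proximal point \<open>p\<close> of
\<open>x\<close> satisfies the implicit Euler relation \<open>(x - p) / \<beta> \<in> subdiff L F p\<close>, which gives uniqueness and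
Lipschitz dependence on \<open>x\<close> for small \<open>\<beta>\<close>. As \<open>\<beta>\<close> tends to 0, \<open>(x - p) / \<beta>\<close> converges to the
subgradient of least norm (lemma \<open>tendsto_min_subgrad\<close>), so the proximal flow is the differential
equation with velocity \<open>- min_subgrad (x t)\<close> (lemma \<open>has_prox_velocity_iff\<close>).

For existence, iterate the proximal map with step sizes tending to 0. A subsequence of the
resulting step curves converges to a Lipschitz curve \<open>x\<close> (lemma \<open>ex_limit_curve\<close>). Estimates for the
iteration pass to the limit: the difference quotients of \<open>- x\<close> at \<open>t\<close> satisfy the subgradient
inequality up to a vanishing error (lemma \<open>limit_curve_variational_ineq\<close>), and they are bounded, up
to a factor tending to 1, by the least norm of a subgradient at the earlier of the two times
(lemma \<open>limit_curve_displacement_le\<close>). That least norm is, up to an exponential factor, nonincreasing in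
time, hence continuous outside a countable set. At each time where it is continuous, both
conditions of the convergence criterion \<open>tendsto_min_subgrad\<close> hold and \<open>x\<close> is differentiable with
the required derivative. No theorem on almost everywhere differentiability is needed.

For uniqueness, the squared distance of two solutions times \<open>exp (- 2 * L * t)\<close> is absolutely
continuous with nonpositive derivative almost everywhere, and such a function is nonincreasing
(lemma \<open>absolutely_continuous_on_nonincreasing\<close>).\<close>

section \<open>Absolutely continuous functions of one variable\<close>

text \<open>An absolutely continuous function whose derivative is nonpositive almost everywhere is
nonincreasing. No integral is needed: in a tagged division that is fine for a suitable gauge,
the intervals with tags in the exceptional set lie in an open set of small measure, where
absolute continuity bounds the total increment; on all other intervals the derivative at the tag
bounds the increment by \<open>e\<close> times the length.\<close>

lemma absolutely_continuous_on_nonincreasing: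
  fixes g :: "real \<Rightarrow> real"
  assumes "a \<le> b" and ac: "absolutely_continuous_on {a..b} g" and N: "negligible N"
    and deriv: "\<And>t. t \<in> {a..b} - N \<Longrightarrow> \<exists>d\<le>0. (g has_vector_derivative d) (at t within {a..b})"
  shows "g b \<le> g a"
proof -
  have bound: "g b - g a \<le> e * (1 + (b - a))" if "e > 0" for e
  proof -
    obtain \<delta> where "\<delta> > 0" and \<delta>: "\<And>\<D>. \<D> division_of \<Union>\<D> \<Longrightarrow> \<Union>\<D> \<subseteq> {a..b} \<Longrightarrow>
        (\<Sum>K\<in>\<D>. Sup K - Inf K) < \<delta> \<Longrightarrow> (\<Sum>K\<in>\<D>. norm (g (Sup K) - g (Inf K))) < e"
      using ac \<open>e > 0\<close> unfolding absolutely_continuous_on_def by meson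
    obtain U where U: "open U" "N \<subseteq> U" "U \<in> lmeasurable" "measure lebesgue U < \<delta>"
    proof -
      have "N \<in> sets lebesgue" "N \<in> null_sets lebesgue"
        using N negligible_iff_null_sets by auto
      then obtain T where T: "open T" "N \<subseteq> T" "T - N \<in> lmeasurable" "emeasure lebesgue (T - N) < ennreal \<delta>"
        using sets_lebesgue_outer_open \<open>\<delta> > 0\<close> by metis
      have "T = (T - N) \<union> N" using T by auto
      then have "T \<in> lmeasurable"
        using T(3) N by (metis fmeasurable.Un negligible_imp_measurable)
      moreover have "emeasure lebesgue T = emeasure lebesgue (T - N)"
        using \<open>N \<in> null_sets lebesgue\<close> T(1) by (simp add: emeasure_Diff_null_set)
      ultimately show ?thesis
        using that[of T] T \<open>\<delta> > 0\<close> by (simp add: emeasure_eq_measure2 ennreal_less_iff)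
    qed
    have "\<exists>r>0. \<forall>u v. u \<in> {a..b} \<and> v \<in> {a..b} \<and> u \<le> t \<and> t \<le> v \<and> \<bar>u - t\<bar> < r \<and> \<bar>v - t\<bar> < r
             \<longrightarrow> g v - g u \<le> e * (v - u)" if t: "t \<in> {a..b} - N" for t
    proof -
      obtain d where "d \<le> 0" and d: "(g has_vector_derivative d) (at t within {a..b})"
        using deriv[OF t] by blast
      obtain r where "r > 0" and r: "\<And>y. y \<in> {a..b} \<Longrightarrow> \<bar>y - t\<bar> < r \<Longrightarrow>
           \<bar>g y - g t - (y - t) * d\<bar> \<le> e * \<bar>y - t\<bar>"
        using d \<open>e > 0\<close> unfolding has_vector_derivative_def has_derivative_within_alt
        by (auto simp: real_norm_def)
      have "g v - g u \<le> e * (v - u)"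
        if "u \<in> {a..b}" "v \<in> {a..b}" "u \<le> t" "t \<le> v" "\<bar>u - t\<bar> < r" "\<bar>v - t\<bar> < r" for u v
      proof -
        have "g v - g t \<le> e * (v - t) + (v - t) * d" "g t - g u \<le> e * (t - u) + (t - u) * d"
          using r[of v] r[of u] that by (auto simp: abs_le_iff algebra_simps)
        moreover have "(v - t) * d \<le> 0" "(t - u) * d \<le> 0"
          using that \<open>d \<le> 0\<close> by (auto simp: mult_nonneg_nonpos)
        ultimately have "g v - g u \<le> e * (v - t) + e * (t - u)" by linarith
        then show ?thesis by (simp add: algebra_simps)
      qed
      then show ?thesis using \<open>r > 0\<close> by blast
    qed
    then obtain r where r0: "\<And>t. t \<in> {a..b} - N \<Longrightarrow> r t > 0"
      and r: "\<And>t u v. t \<in> {a..b} - N \<Longrightarrow> u \<in> {a..b} \<Longrightarrow> v \<in> {a..b} \<Longrightarrow> u \<le> t \<Longrightarrow> t \<le> v \<Longrightarrow>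
           \<bar>u - t\<bar> < r t \<Longrightarrow> \<bar>v - t\<bar> < r t \<Longrightarrow> g v - g u \<le> e * (v - u)"
      by metis
    define \<gamma> where "\<gamma> t = (if t \<in> N then U else if t \<in> {a..b} then ball t (r t) else UNIV)" for t
    have "gauge \<gamma>"
      unfolding gauge_def \<gamma>_def using U r0 by auto
    then obtain p where p: "p tagged_division_of {a..b}" "\<gamma> fine p"
      using fine_division_exists_real by blast
    define q where "q = {(x,K) \<in> p. x \<in> N}"
    have fin: "finite p" using p(1) by blast
    have "q \<subseteq> p" unfolding q_def by auto
    have q: "q tagged_partial_division_of {a..b}"
      using tagged_partial_division_subset[OF _ \<open>q \<subseteq> p\<close>] p(1) tagged_division_of_def by blast
    have K: "\<exists>u v. K = {u..v} \<and> u \<le> x \<and> x \<le> v \<and> u \<in> {a..b} \<and> v \<in> {a..b} \<and> K \<subseteq> \<gamma> x"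
      if xK: "(x, K) \<in> p" for x K
    proof -
      obtain u v where "K = {u..v}" using tagged_division_ofD(4)[OF p(1) xK] by auto
      moreover have "x \<in> K" "K \<subseteq> {a..b}"
        using tagged_division_ofD(2,3)[OF p(1) xK] by auto
      moreover have "K \<subseteq> \<gamma> x" using p(2) xK by (auto simp: fine_def)
      ultimately show ?thesis by auto
    qed
    have D: "(snd ` q) division_of \<Union>(snd ` q)"
      using partial_division_of_tagged_division[OF q] .
    have sub: "\<Union>(snd ` q) \<subseteq> {a..b}"
      using q unfolding tagged_partial_division_of_def by fastforce
    have subU: "\<Union>(snd ` q) \<subseteq> U"
      using K \<open>q \<subseteq> p\<close> unfolding q_def \<gamma>_def by fastforce
    have "(\<Sum>K\<in>snd ` q. Sup K - Inf K) = (\<Sum>K\<in>snd ` q. measure lebesgue K)"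
    proof (rule sum.cong)
      fix L assume "L \<in> snd ` q"
      then obtain u v x where "L = {u..v}" "u \<le> v" using K \<open>q \<subseteq> p\<close> by force
      then show "Sup L - Inf L = measure lebesgue L" by simp
    qed simp
    also have "\<dots> = measure lebesgue (\<Union>(snd ` q))"
      using content_division[OF D] .
    also have "\<dots> \<le> measure lebesgue U"
      using subU U(3) lmeasurable_division[OF D] by (intro measure_mono_fmeasurable) auto
    finally have "(\<Sum>K\<in>snd ` q. norm (g (Sup K) - g (Inf K))) < e"
      using U(4) \<delta>[OF D sub] by linarith
    moreover have "(\<Sum>(x,K)\<in>q. norm (g (Sup K) - g (Inf K))) = (\<Sum>K\<in>snd ` q. norm (g (Sup K) - g (Inf K)))"
    proof -
      \<comment> \<open>\<open>Sup {}\<close> and \<open>Inf {}\<close> are unspecified reals, so the empty set needs a value of its own.\<close>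
      let ?d = "\<lambda>K. if K = {} then 0 else norm (g (Sup K) - g (Inf K))"
      have "(\<Sum>(x,K)\<in>q. ?d K) = (\<Sum>K\<in>snd ` q. ?d K)"
        by (rule sum.over_tagged_division_lemma[OF tagged_partial_division_of_Union_self[OF q]]) auto
      moreover have "(\<Sum>(x,K)\<in>q. ?d K) = (\<Sum>(x,K)\<in>q. norm (g (Sup K) - g (Inf K)))"
        using K \<open>q \<subseteq> p\<close> by (intro sum.cong) fastforce+
      moreover have "(\<Sum>K\<in>snd ` q. ?d K) = (\<Sum>K\<in>snd ` q. norm (g (Sup K) - g (Inf K)))"
        using K \<open>q \<subseteq> p\<close> by (intro sum.cong) fastforce+
      ultimately show ?thesis by simp
    qed
    moreover have "(\<Sum>(x,K)\<in>q. g (Sup K) - g (Inf K)) \<le> (\<Sum>(x,K)\<in>q. norm (g (Sup K) - g (Inf K)))"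
      by (rule sum_mono) (auto simp: abs_ge_self)
    ultimately have q_le: "(\<Sum>(x,K)\<in>q. g (Sup K) - g (Inf K)) \<le> e" by linarith
    have "(\<Sum>(x,K)\<in>p - q. g (Sup K) - g (Inf K)) \<le> (\<Sum>(x,K)\<in>p - q. e * (Sup K - Inf K))"
    proof (rule sum_mono, clarify)
      fix x L assume xL: "(x, L) \<in> p" "(x, L) \<notin> q"
      then obtain u v where uv: "L = {u..v}" "u \<le> x" "x \<le> v" "u \<in> {a..b}" "v \<in> {a..b}" "L \<subseteq> \<gamma> x"
        using K by blast
      have x: "x \<in> {a..b} - N" using uv xL unfolding q_def by auto
      then have "{u..v} \<subseteq> ball x (r x)" using uv unfolding \<gamma>_def by auto
      moreover have "u \<in> {u..v}" "v \<in> {u..v}" using uv by auto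
      ultimately have "u \<in> ball x (r x)" "v \<in> ball x (r x)" by blast+
      then show "g (Sup L) - g (Inf L) \<le> e * (Sup L - Inf L)"
        using r[OF x uv(4,5,2,3)] uv(1-3) by (simp add: dist_real_def abs_minus_commute)
    qed
    also have "\<dots> \<le> (\<Sum>(x,K)\<in>p. e * (Sup K - Inf K))"
    proof (rule sum_mono2[OF fin])
      fix z assume "z \<in> p - (p - q)"
      then show "0 \<le> (case z of (x, K) \<Rightarrow> e * (Sup K - Inf K))"
        using K[of "fst z" "snd z"] \<open>e > 0\<close> by (cases z) auto
    qed auto
    also have "\<dots> = e * (\<Sum>(x,K)\<in>p. Sup K - Inf K)"
      by (simp add: sum_distrib_left split_def)
    also have "\<dots> = e * (b - a)"
      using additive_tagged_division_1[OF \<open>a \<le> b\<close> p(1), of "\<lambda>x. x"] by simp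
    finally have "(\<Sum>(x,K)\<in>p. g (Sup K) - g (Inf K)) \<le> e + e * (b - a)"
      using q_le sum.subset_diff[OF \<open>q \<subseteq> p\<close> fin, of "\<lambda>(x,K). g (Sup K) - g (Inf K)"] by linarith
    then show ?thesis
      using additive_tagged_division_1[OF \<open>a \<le> b\<close> p(1), of g] by (simp add: algebra_simps)
  qed
  show ?thesis
  proof (rule field_le_epsilon)
    fix e :: real assume "e > 0"
    then have "g b - g a \<le> e / (1 + (b - a)) * (1 + (b - a))"
      using \<open>a \<le> b\<close> by (intro bound) auto
    also have "\<dots> = e" using \<open>a \<le> b\<close> by (intro nonzero_divide_eq_eq[THEN iffD1, symmetric]) auto
    finally show "g b \<le> g a + e" by simp
  qed
qed

lemma absolutely_continuous_on_imp_continuous_on: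
  fixes x :: "real \<Rightarrow> 'a::real_normed_vector"
  assumes "absolutely_continuous_on {a..b} x"
  shows "continuous_on {a..b} x"
  unfolding continuous_on_iff
proof (intro ballI allI impI)
  fix s e :: real assume s: "s \<in> {a..b}" and "0 < e"
  then obtain d where "d > 0" and d: "\<And>\<D>. \<D> division_of \<Union>\<D> \<Longrightarrow> \<Union>\<D> \<subseteq> {a..b} \<Longrightarrow>
        (\<Sum>K\<in>\<D>. Sup K - Inf K) < d \<Longrightarrow> (\<Sum>K\<in>\<D>. norm (x (Sup K) - x (Inf K))) < e"
    using assms unfolding absolutely_continuous_on_def by meson
  have *: "norm (x v - x u) < e" if "u \<le> v" "u \<in> {a..b}" "v \<in> {a..b}" "v - u < d" for u v
    using d[of "{{u..v}}"] that division_of_self[of u v] by auto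
  have "dist (x t) (x s) < e" if "t \<in> {a..b}" "dist t s < d" for t
    using *[of s t] *[of t s] s that
    by (cases "s \<le> t") (auto simp: dist_norm norm_minus_commute)
  then show "\<exists>d>0. \<forall>t\<in>{a..b}. dist t s < d \<longrightarrow> dist (x t) (x s) < e"
    using \<open>d > 0\<close> by blast
qed

lemma absolutely_continuous_on_dominated:
  fixes g :: "real \<Rightarrow> 'c::real_normed_vector"
  assumes x: "absolutely_continuous_on S x" and y: "absolutely_continuous_on S y" and "C \<ge> 0"
    and dom: "\<And>s t. s \<in> S \<Longrightarrow> t \<in> S \<Longrightarrow> s \<le> t \<Longrightarrow>
      norm (g t - g s) \<le> C * (norm (x t - x s) + norm (y t - y s) + (t - s))"
  shows "absolutely_continuous_on S g"
  unfolding absolutely_continuous_on_def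
proof (intro allI impI)
  fix e :: real assume "e > 0"
  define \<eta> where "\<eta> = e / (C + 1) / 3"
  have "\<eta> > 0" using \<open>e > 0\<close> \<open>C \<ge> 0\<close> by (simp add: \<eta>_def)
  obtain d1 where "d1 > 0" and d1: "\<And>\<D>. \<D> division_of \<Union>\<D> \<Longrightarrow> \<Union>\<D> \<subseteq> S \<Longrightarrow>
        (\<Sum>K\<in>\<D>. Sup K - Inf K) < d1 \<Longrightarrow> (\<Sum>K\<in>\<D>. norm (x (Sup K) - x (Inf K))) < \<eta>"
    using x \<open>\<eta> > 0\<close> unfolding absolutely_continuous_on_def by meson
  obtain d2 where "d2 > 0" and d2: "\<And>\<D>. \<D> division_of \<Union>\<D> \<Longrightarrow> \<Union>\<D> \<subseteq> S \<Longrightarrow>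
        (\<Sum>K\<in>\<D>. Sup K - Inf K) < d2 \<Longrightarrow> (\<Sum>K\<in>\<D>. norm (y (Sup K) - y (Inf K))) < \<eta>"
    using y \<open>\<eta> > 0\<close> unfolding absolutely_continuous_on_def by meson
  have "(\<Sum>K\<in>\<D>. norm (g (Sup K) - g (Inf K))) < e"
    if D: "\<D> division_of \<Union>\<D>" "\<Union>\<D> \<subseteq> S" "(\<Sum>K\<in>\<D>. Sup K - Inf K) < min (min d1 d2) \<eta>" for \<D>
  proof -
    have "(\<Sum>K\<in>\<D>. norm (g (Sup K) - g (Inf K)))
        \<le> (\<Sum>K\<in>\<D>. C * (norm (x (Sup K) - x (Inf K)) + norm (y (Sup K) - y (Inf K)) + (Sup K - Inf K)))"
    proof (rule sum_mono)
      fix K assume K: "K \<in> \<D>"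
      then obtain u v where "K = cbox u v" using division_ofD(4)[OF D(1)] by blast
      moreover have "K \<noteq> {}" using division_ofD(3)[OF D(1) K] .
      ultimately have uv: "K = {u..v}" "u \<le> v" by auto
      then have "u \<in> K" "v \<in> K" by auto
      then have "u \<in> S" "v \<in> S" using K D(2) by blast+
      then show "norm (g (Sup K) - g (Inf K))
         \<le> C * (norm (x (Sup K) - x (Inf K)) + norm (y (Sup K) - y (Inf K)) + (Sup K - Inf K))"
        using dom[of u v] uv by simp
    qed
    also have "\<dots> = C * ((\<Sum>K\<in>\<D>. norm (x (Sup K) - x (Inf K))) + (\<Sum>K\<in>\<D>. norm (y (Sup K) - y (Inf K)))
        + (\<Sum>K\<in>\<D>. Sup K - Inf K))"
      by (simp add: sum_distrib_left[symmetric] sum.distrib)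
    also have "\<dots> \<le> C * (\<eta> + \<eta> + \<eta>)"
      using d1[OF D(1,2)] d2[OF D(1,2)] D(3) \<open>C \<ge> 0\<close> by (intro mult_left_mono add_mono) auto
    also have "\<dots> < (C + 1) * (3 * \<eta>)"
      using \<open>\<eta> > 0\<close> by (simp add: algebra_simps)
    also have "\<dots> = e"
    proof -
      have "C + 1 \<noteq> 0" using \<open>C \<ge> 0\<close> by simp
      then show ?thesis unfolding \<eta>_def by (simp only: times_divide_eq_right) simp
    qed
    finally show ?thesis .
  qed
  then show "\<exists>\<delta>>0. \<forall>\<D>. \<D> division_of \<Union>\<D> \<and> \<Union>\<D> \<subseteq> S \<and> (\<Sum>K\<in>\<D>. Sup K - Inf K) < \<delta> \<longrightarrow>
        (\<Sum>K\<in>\<D>. norm (g (Sup K) - g (Inf K))) < e"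
    using \<open>d1 > 0\<close> \<open>d2 > 0\<close> \<open>\<eta> > 0\<close> by (intro exI[of _ "min (min d1 d2) \<eta>"]) auto
qed

lemma absolutely_continuous_on_const: "absolutely_continuous_on S (\<lambda>_. c)"
  unfolding absolutely_continuous_on_def by (auto intro: exI[of _ 1])

section \<open>Weakly convex functions and their subgradients\<close>

text \<open>Weak convexity: adding \<open>L / 2\<close> times the squared norm makes the function convex. The modulus \<open>L\<close> may
have either sign.\<close>

definition weakly_convex :: "real \<Rightarrow> ('a::real_inner \<Rightarrow> real) \<Rightarrow> bool" where
  "weakly_convex L F \<longleftrightarrow> convex_on UNIV (\<lambda>x. F x + L / 2 * (norm x)\<^sup>2)"

lemma weakly_convexD:
  fixes x y :: "'a::real_inner"
  assumes "weakly_convex L F" "0 \<le> u" "u \<le> 1"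
  shows "F ((1 - u) *\<^sub>R x + u *\<^sub>R y) \<le> (1 - u) * F x + u * F y + L / 2 * (u * (1 - u) * (norm (y - x))\<^sup>2)"
proof -
  have "(norm ((1 - u) *\<^sub>R x + u *\<^sub>R y))\<^sup>2 = (1 - u) * (norm x)\<^sup>2 + u * (norm y)\<^sup>2 - u * (1 - u) * (norm (y - x))\<^sup>2"
    unfolding power2_norm_eq_inner
    by (simp add: inner_simps inner_commute algebra_simps power2_eq_square)
  moreover have "F ((1 - u) *\<^sub>R x + u *\<^sub>R y) + L / 2 * (norm ((1 - u) *\<^sub>R x + u *\<^sub>R y))\<^sup>2
     \<le> (1 - u) * (F x + L / 2 * (norm x)\<^sup>2) + u * (F y + L / 2 * (norm y)\<^sup>2)"
    using convex_onD[OF assms(1)[unfolded weakly_convex_def], of u x y] assms by simp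
  ultimately have "F ((1 - u) *\<^sub>R x + u *\<^sub>R y)
      \<le> (1 - u) * (F x + L / 2 * (norm x)\<^sup>2) + u * (F y + L / 2 * (norm y)\<^sup>2)
        - L / 2 * ((1 - u) * (norm x)\<^sup>2 + u * (norm y)\<^sup>2 - u * (1 - u) * (norm (y - x))\<^sup>2)"
    by simp
  also have "\<dots> = (1 - u) * F x + u * F y + L / 2 * (u * (1 - u) * (norm (y - x))\<^sup>2)"
  proof -
    have "(1 - u) * (A + l * a) + u * (B + l * b) - l * ((1 - u) * a + u * b - w) = (1 - u) * A + u * B + l * w"
      for l a b w A B :: real
      by (simp add: algebra_simps)
    then show ?thesis .
  qed
  finally show ?thesis .
qed

lemma convex_on_power2_norm: "convex_on UNIV (\<lambda>x::'a::real_inner. (norm x)\<^sup>2)"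
proof (rule convex_onI)
  fix t :: real and x y :: 'a assume "0 < t" "t < 1"
  have "(norm ((1 - t) *\<^sub>R x + t *\<^sub>R y))\<^sup>2 = (1 - t) * (norm x)\<^sup>2 + t * (norm y)\<^sup>2 - t * (1 - t) * (norm (y - x))\<^sup>2"
    unfolding power2_norm_eq_inner
    by (simp add: inner_simps inner_commute algebra_simps power2_eq_square)
  then show "(norm ((1 - t) *\<^sub>R x + t *\<^sub>R y))\<^sup>2 \<le> (1 - t) * (norm x)\<^sup>2 + t * (norm y)\<^sup>2"
    using \<open>0 < t\<close> \<open>t < 1\<close> by simp
qed simp

lemma weakly_convex_mono:
  assumes "weakly_convex L F" "L \<le> M"
  shows "weakly_convex M F"
proof -
  have "convex_on UNIV (\<lambda>x. (F x + L / 2 * (norm x)\<^sup>2) + ((M - L) / 2) * (norm x)\<^sup>2)"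
    using assms(2)
    by (intro convex_on_add[OF assms(1)[unfolded weakly_convex_def]] convex_on_cmul convex_on_power2_norm) auto
  moreover have "(F x + L / 2 * (norm x)\<^sup>2) + ((M - L) / 2) * (norm x)\<^sup>2 = F x + M / 2 * (norm x)\<^sup>2" for x
    by (simp add: field_simps)
  ultimately show ?thesis unfolding weakly_convex_def by (simp only:)
qed

text \<open>Along each line, the derivative of \<open>f\<close> plus \<open>L / 2\<close> times the squared norm is nondecreasing, because
the gradient of \<open>f\<close> is \<open>L\<close>-Lipschitz.\<close>

lemma L_smooth_imp_weakly_convex:
  fixes f :: "'a::real_inner \<Rightarrow> real"
  assumes "L_smooth L f"
  shows "weakly_convex L f"
proof -
  obtain grad where grad: "\<And>x. GDERIV f x :> grad x"
    and lip: "\<And>x y. norm (grad x - grad y) \<le> L * norm (x - y)"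
    using assms unfolding L_smooth_def by blast
  show ?thesis
    unfolding weakly_convex_def
  proof (rule convex_onI)
    fix u :: real and x y :: 'a assume u: "0 < u" "u < 1"
    define d where "d = y - x"
    define \<phi> where "\<phi> t = f (x + t *\<^sub>R d) + L / 2 * (norm (x + t *\<^sub>R d))\<^sup>2" for t
    have "convex_on UNIV \<phi>"
    proof (rule convex_on_realI)
      fix t :: real
      have f: "((\<lambda>t. f (x + t *\<^sub>R d)) has_derivative (\<lambda>h. (h *\<^sub>R d) \<bullet> grad (x + t *\<^sub>R d))) (at t)"
        using grad[of "x + t *\<^sub>R d"] unfolding gderiv_def
        by (rule has_derivative_compose[rotated]) (auto intro!: derivative_eq_intros)
      show "(\<phi> has_real_derivative (grad (x + t *\<^sub>R d) + L *\<^sub>R (x + t *\<^sub>R d)) \<bullet> d) (at t)"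
      proof -
        have n: "((\<lambda>t. (norm (x + t *\<^sub>R d))\<^sup>2) has_derivative (\<lambda>h. 2 * ((x + t *\<^sub>R d) \<bullet> (h *\<^sub>R d)))) (at t)"
          unfolding power2_norm_eq_inner
          by (auto intro!: derivative_eq_intros simp: inner_commute)
        have "(\<phi> has_derivative (\<lambda>h. (h *\<^sub>R d) \<bullet> grad (x + t *\<^sub>R d) + L / 2 * (2 * ((x + t *\<^sub>R d) \<bullet> (h *\<^sub>R d))))) (at t)"
          unfolding \<phi>_def by (intro has_derivative_add has_derivative_mult_right f n)
        moreover have "(\<lambda>h. (h *\<^sub>R d) \<bullet> grad (x + t *\<^sub>R d) + L / 2 * (2 * ((x + t *\<^sub>R d) \<bullet> (h *\<^sub>R d))))
            = (*) ((grad (x + t *\<^sub>R d) + L *\<^sub>R (x + t *\<^sub>R d)) \<bullet> d)"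
        proof
          fix h
          have "2 * ((x + t *\<^sub>R d) \<bullet> (h *\<^sub>R d)) = 2 * (h * ((x + t *\<^sub>R d) \<bullet> d))"
            by simp
          then show "(h *\<^sub>R d) \<bullet> grad (x + t *\<^sub>R d) + L / 2 * (2 * ((x + t *\<^sub>R d) \<bullet> (h *\<^sub>R d)))
            = ((grad (x + t *\<^sub>R d) + L *\<^sub>R (x + t *\<^sub>R d)) \<bullet> d) * h"
            by (simp add: inner_add_left[of "grad (x + t *\<^sub>R d)"] inner_commute[of d] distrib_right)
        qed
        ultimately show ?thesis unfolding has_field_derivative_def by simp
      qed
    next
      fix s t :: real assume "s \<le> t"
      have "\<bar>(grad (x + t *\<^sub>R d) - grad (x + s *\<^sub>R d)) \<bullet> d\<bar> \<le> L * norm ((t - s) *\<^sub>R d) * norm d"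
        using Cauchy_Schwarz_ineq2[of "grad (x + t *\<^sub>R d) - grad (x + s *\<^sub>R d)" d]
          mult_right_mono[OF lip[of "x + t *\<^sub>R d" "x + s *\<^sub>R d"], of "norm d"]
        by (simp add: algebra_simps)
      also have "\<dots> = L * (t - s) * (d \<bullet> d)"
        using \<open>s \<le> t\<close> by (simp add: power2_norm_eq_inner[symmetric] power2_eq_square)
      finally show "(grad (x + s *\<^sub>R d) + L *\<^sub>R (x + s *\<^sub>R d)) \<bullet> d \<le> (grad (x + t *\<^sub>R d) + L *\<^sub>R (x + t *\<^sub>R d)) \<bullet> d"
        by (simp add: inner_simps algebra_simps)
    qed auto
    from convex_onD[OF this, of u 0 1] u have "\<phi> u \<le> (1 - u) * \<phi> 0 + u * \<phi> 1" by simp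
    moreover have "(1 - u) *\<^sub>R x + u *\<^sub>R y = x + u *\<^sub>R d" by (simp add: d_def algebra_simps)
    ultimately show "f ((1 - u) *\<^sub>R x + u *\<^sub>R y) + L / 2 * (norm ((1 - u) *\<^sub>R x + u *\<^sub>R y))\<^sup>2
       \<le> (1 - u) * (f x + L / 2 * (norm x)\<^sup>2) + u * (f y + L / 2 * (norm y)\<^sup>2)"
      by (simp add: \<phi>_def d_def)
  qed simp
qed

lemma weakly_convex_imp_continuous_on:
  fixes F :: "'a::euclidean_space \<Rightarrow> real"
  assumes "weakly_convex L F"
  shows "continuous_on UNIV F"
proof -
  have "continuous_on UNIV (\<lambda>x. F x + L / 2 * (norm x)\<^sup>2)"
    by (rule convex_on_continuous[OF open_UNIV assms[unfolded weakly_convex_def]])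
  then have "continuous_on UNIV (\<lambda>x. (F x + L / 2 * (norm x)\<^sup>2) - L / 2 * (norm x)\<^sup>2)"
    by (rule continuous_on_diff) (intro continuous_intros)
  then show ?thesis by (simp only: add_diff_cancel_right')
qed

text \<open>The subdifferential of a weakly convex function: \<open>g\<close> belongs to it at \<open>x\<close> when the affine function
with slope \<open>g\<close>, lowered by \<open>L / 2\<close> times the squared distance to \<open>x\<close>, touches \<open>F\<close> from below at \<open>x\<close>. The
inequality is global, so closedness and convexity of the set and the closedness of its graph
follow without any assumption on \<open>F\<close> beyond continuity.\<close>

definition subdiff :: "real \<Rightarrow> ('a::real_inner \<Rightarrow> real) \<Rightarrow> 'a \<Rightarrow> 'a set" where
  "subdiff L F x = {g. \<forall>y. F x + g \<bullet> (y - x) - L / 2 * (norm (y - x))\<^sup>2 \<le> F y}"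

lemma subdiff_iff: "g \<in> subdiff L F x \<longleftrightarrow> (\<forall>y. g \<bullet> (y - x) \<le> F y - F x + L / 2 * (norm (y - x))\<^sup>2)"
  unfolding subdiff_def by (auto simp: algebra_simps)

lemma closed_subdiff: "closed (subdiff L F x)"
proof -
  have "subdiff L F x = (\<Inter>y. {g. g \<bullet> (y - x) \<le> F y - F x + L / 2 * (norm (y - x))\<^sup>2})"
    by (auto simp: subdiff_iff)
  then show ?thesis
    by (simp only:) (intro closed_INT ballI closed_Collect_le continuous_intros)
qed

lemma convex_subdiff: "convex (subdiff L F x)"
proof (rule convexI)
  fix g h and u v :: real
  assume gh: "g \<in> subdiff L F x" "h \<in> subdiff L F x" and uv: "0 \<le> u" "0 \<le> v" "u + v = 1"
  have "(u *\<^sub>R g + v *\<^sub>R h) \<bullet> (y - x) \<le> F y - F x + L / 2 * (norm (y - x))\<^sup>2" for y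
  proof -
    have "u * (g \<bullet> (y - x)) + v * (h \<bullet> (y - x)) \<le> F y - F x + L / 2 * (norm (y - x))\<^sup>2"
      using gh uv by (intro convex_bound_le) (auto simp: subdiff_iff)
    then show ?thesis by (simp add: inner_add_left)
  qed
  then show "u *\<^sub>R g + v *\<^sub>R h \<in> subdiff L F x" by (simp add: subdiff_iff)
qed

lemma subdiff_hypomonotone:
  assumes "g \<in> subdiff L F x" "h \<in> subdiff L F y"
  shows "(g - h) \<bullet> (x - y) \<ge> - L * (norm (x - y))\<^sup>2"
proof -
  have "g \<bullet> (y - x) \<le> F y - F x + L / 2 * (norm (y - x))\<^sup>2" "h \<bullet> (x - y) \<le> F x - F y + L / 2 * (norm (x - y))\<^sup>2"
    using assms by (auto simp: subdiff_iff)
  then have "g \<bullet> (y - x) + h \<bullet> (x - y) \<le> L * (norm (x - y))\<^sup>2"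
    by (simp add: norm_minus_commute)
  moreover have "(g - h) \<bullet> (x - y) = - (g \<bullet> (y - x) + h \<bullet> (x - y))"
    by (simp add: inner_diff_left inner_diff_right)
  ultimately show ?thesis by simp
qed

text \<open>The graph of the subdifferential is closed, and a norm bound on the subgradients survives the
passage to the limit even when the subgradients themselves do not converge.\<close>

lemma subdiff_bounded_limit:
  fixes F :: "'a::euclidean_space \<Rightarrow> real"
  assumes cont: "continuous_on UNIV F" and y: "y \<longlonglongrightarrow> z"
    and g: "\<forall>\<^sub>F n in sequentially. g n \<in> subdiff L F (y n)"
    and le: "\<forall>\<^sub>F n in sequentially. norm (g n) \<le> b n" and b: "b \<longlonglongrightarrow> B"
  shows "\<exists>w \<in> subdiff L F z. norm w \<le> B"
proof -
  obtain C where C: "\<And>n. norm (b n) \<le> C"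
    using b convergentI convergent_imp_Bseq Bseq_def by metis
  obtain N where N: "\<And>n. n \<ge> N \<Longrightarrow> g n \<in> subdiff L F (y n) \<and> norm (g n) \<le> b n"
    using eventually_conj[OF g le] unfolding eventually_sequentially by blast
  have "bounded (range (\<lambda>n. g (n + N)))"
  proof -
    have "norm (g (n + N)) \<le> C" for n
      using N[of "n + N"] C[of "n + N"] by auto
    then show ?thesis unfolding bounded_iff by auto
  qed
  from bounded_imp_convergent_subsequence[OF this]
  obtain w r where r: "strict_mono r" and w: "((\<lambda>n. g (n + N)) \<circ> r) \<longlonglongrightarrow> w"
    by auto
  have w: "(\<lambda>n. g (r n + N)) \<longlonglongrightarrow> w" using w by (simp add: o_def)
  have r': "filterlim (\<lambda>n. r n + N) sequentially sequentially"
    by (rule filterlim_compose[OF filterlim_add_const_nat_at_top filterlim_subseq[OF r]])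
  have yr: "(\<lambda>n. y (r n + N)) \<longlonglongrightarrow> z" and br: "(\<lambda>n. b (r n + N)) \<longlonglongrightarrow> B"
    using filterlim_compose[OF y r'] filterlim_compose[OF b r'] .
  have Fr: "(\<lambda>n. F (y (r n + N))) \<longlonglongrightarrow> F z"
    using continuous_on_tendsto_compose[OF cont yr] by simp
  have "w \<bullet> (v - z) \<le> F v - F z + L / 2 * (norm (v - z))\<^sup>2" for v
  proof (rule LIMSEQ_le)
    show "(\<lambda>n. g (r n + N) \<bullet> (v - y (r n + N))) \<longlonglongrightarrow> w \<bullet> (v - z)"
      by (intro tendsto_intros w yr)
    show "(\<lambda>n. F v - F (y (r n + N)) + L / 2 * (norm (v - y (r n + N)))\<^sup>2) \<longlonglongrightarrow> F v - F z + L / 2 * (norm (v - z))\<^sup>2"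
      by (intro tendsto_intros Fr yr)
    show "\<exists>M. \<forall>n\<ge>M. g (r n + N) \<bullet> (v - y (r n + N)) \<le> F v - F (y (r n + N)) + L / 2 * (norm (v - y (r n + N)))\<^sup>2"
      using N by (auto simp: subdiff_iff)
  qed
  moreover have "norm w \<le> B"
    using LIMSEQ_le[OF tendsto_norm[OF w] br] N by auto
  ultimately show ?thesis by (auto simp: subdiff_iff)
qed

text \<open>A global lower bound with a linear and a quadratic error term. It makes the objective of the
proximal map coercive and bounds the length of a proximal step by a multiple of the step size.\<close>

lemma weakly_convex_lower_bound:
  fixes F :: "'a::euclidean_space \<Rightarrow> real"
  assumes F: "weakly_convex L F"
  obtains K where "K \<ge> 0" "\<And>p. F x - K * norm (p - x) - L / 2 * (norm (p - x))\<^sup>2 \<le> F p"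
proof -
  have "compact (sphere x 1)" by simp
  then have "bounded (F ` sphere x 1)"
    by (intro compact_imp_bounded compact_continuous_image
        continuous_on_subset[OF weakly_convex_imp_continuous_on[OF F]]) auto
  then obtain C where C: "\<And>u. u \<in> sphere x 1 \<Longrightarrow> \<bar>F u\<bar> \<le> C"
    unfolding bounded_iff by (metis imageI real_norm_def)
  define K where "K = \<bar>C - F x + L / 2\<bar>"
  have "F x - K * norm (p - x) - L / 2 * (norm (p - x))\<^sup>2 \<le> F p" for p
  proof (cases "p = x")
    case False
    define s where "s = norm (p - x)"
    have s: "s > 0" using False by (simp add: s_def)
    \<comment> \<open>The point \<open>u\<close> at distance 1 from \<open>x\<close> lies opposite to \<open>p\<close>, so that \<open>x\<close> is a convex combination of \<open>p\<close> and \<open>u\<close>.\<close>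
    define u where "u = x - (1 / s) *\<^sub>R (p - x)"
    have "u \<in> sphere x 1" using s by (simp add: u_def s_def dist_norm)
    then have Fu: "F u \<le> C" using C by force
    have up: "u - p = - ((1 / s + 1) *\<^sub>R (p - x))"
      by (simp add: u_def algebra_simps)
    have "norm (u - p) = (1 / s + 1) * s"
      unfolding up using s by (simp add: s_def[symmetric])
    also have "\<dots> = 1 + s"
      using s by (simp add: distrib_right)
    finally have "norm (u - p) = 1 + s" .
    moreover have "(1 - s / (1 + s)) *\<^sub>R p + (s / (1 + s)) *\<^sub>R u = x"
    proof -
      have "(1 - c) *\<^sub>R p + c *\<^sub>R u = p + c *\<^sub>R (u - p)" for c
        by (simp add: algebra_simps)
      moreover have "(s / (1 + s)) * (1 / s + 1) = 1"
      proof -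
        have "1 / s + 1 = (1 + s) / s" "1 + s \<noteq> 0"
          using s by (simp_all add: add_divide_distrib)
        then show ?thesis using s by simp
      qed
      ultimately show ?thesis
        by (simp only: up scaleR_minus_right scaleR_scaleR scaleR_one) simp
    qed
    ultimately have le: "F x \<le> (1 - s / (1 + s)) * F p + (s / (1 + s)) * F u
        + L / 2 * ((s / (1 + s)) * (1 - s / (1 + s)) * (1 + s)\<^sup>2)"
      using weakly_convexD[OF F, of "s / (1 + s)" p u] s by simp
    define c where "c = 1 / (1 + s)"
    have c: "c * (1 + s) = 1" "s / (1 + s) = s * c" using s by (auto simp: c_def)
    have c': "1 - s * c = c" using c(1) by algebra
    have "F x * (1 + s) \<le> (c * F p + (s * c) * F u + L / 2 * ((s * c) * c * (1 + s)\<^sup>2)) * (1 + s)"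
      using le s unfolding c(2) c' by (intro mult_right_mono) auto
    also have "\<dots> = (c * (1 + s)) * F p + (c * (1 + s)) * (s * F u) + L / 2 * ((c * (1 + s))\<^sup>2 * (s * (1 + s)))"
    proof -
      have "(c * A + (s * c) * B + M * ((s * c) * c * a\<^sup>2)) * a = (c * a) * A + (c * a) * (s * B) + M * ((c * a)\<^sup>2 * (s * a))"
        for a A B M :: real
        by (simp add: algebra_simps power2_eq_square)
      then show ?thesis .
    qed
    also have "\<dots> = F p + s * F u + L / 2 * (s * (1 + s))"
      by (simp only: c(1)) simp
    also have "\<dots> \<le> F p + s * C + L / 2 * (s * (1 + s))"
      using Fu s by simp
    finally have "F x * (1 + s) \<le> F p + s * C + L / 2 * (s * (1 + s))" .
    moreover have "F x - s * (C - F x + L / 2) - L / 2 * s\<^sup>2 = F x * (1 + s) - s * C - L / 2 * (s * (1 + s))"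
      by (simp add: algebra_simps power2_eq_square)
    ultimately have "F x - s * (C - F x + L / 2) - L / 2 * s\<^sup>2 \<le> F p" by linarith
    moreover have "s * (C - F x + L / 2) \<le> K * s"
    proof -
      have "(C - F x + L / 2) * s \<le> K * s"
        using s by (intro mult_right_mono) (auto simp: K_def)
      then show ?thesis by (simp only: mult.commute[of s])
    qed
    ultimately show ?thesis unfolding s_def by linarith
  qed simp
  moreover have "K \<ge> 0" by (simp add: K_def)
  ultimately show ?thesis by (rule that[rotated])
qed

section \<open>The proximal map of a weakly convex function\<close>

lemma is_prox_imp_subdiff:
  fixes x p :: "'a::real_inner"
  assumes F: "weakly_convex L F" and "0 < \<beta>" and p: "is_prox \<beta> F x p"
  shows "(1 / \<beta>) *\<^sub>R (x - p) \<in> subdiff L F p"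
  unfolding subdiff_iff
proof
  fix y
  define d where "d = y - p"
  have min: "F p + 1 / (2 * \<beta>) * (norm (x - p))\<^sup>2 \<le> F z + 1 / (2 * \<beta>) * (norm (x - z))\<^sup>2" for z
    using p unfolding is_prox_def is_arg_min_def by (auto simp: not_less)
  \<comment> \<open>Compare \<open>p\<close> with the points of the segment from \<open>p\<close> to \<open>y\<close>, divide by \<open>u\<close>, and let \<open>u\<close> tend to 0.\<close>
  have ineq: "1 / \<beta> * ((x - p) \<bullet> d) \<le> F y - F p + L / 2 * ((1 - u) * (norm d)\<^sup>2) + 1 / (2 * \<beta>) * (u * (norm d)\<^sup>2)"
    if u: "0 < u" "u < 1" for u
  proof -
    have z: "(1 - u) *\<^sub>R p + u *\<^sub>R y = p + u *\<^sub>R d" by (simp add: d_def algebra_simps)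
    have n: "(norm (x - (p + u *\<^sub>R d)))\<^sup>2 = (norm (x - p))\<^sup>2 - u * (2 * ((x - p) \<bullet> d)) + u * (u * (norm d)\<^sup>2)"
      unfolding power2_norm_eq_inner by (simp add: inner_simps inner_commute algebra_simps)
    have "F p + 1 / (2 * \<beta>) * (norm (x - p))\<^sup>2
        \<le> (1 - u) * F p + u * F y + L / 2 * (u * (1 - u) * (norm d)\<^sup>2)
          + 1 / (2 * \<beta>) * ((norm (x - p))\<^sup>2 - u * (2 * ((x - p) \<bullet> d)) + u * (u * (norm d)\<^sup>2))"
      using min[of "p + u *\<^sub>R d"] weakly_convexD[OF F, of u p y] u unfolding z n d_def[symmetric] by linarith
    moreover have "(1 - u) * A + u * B + l * (u * (1 - u) * D) + b / 2 * (N - u * (2 * I) + u * (u * D)) - (A + b / 2 * N)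
        = u * (B - A + l * ((1 - u) * D) + b / 2 * (u * D) - b * I)"
      for A B l D N I b :: real
      by (simp add: field_simps)
    from this[of "F p" "F y" "L / 2" "(norm d)\<^sup>2" "1 / \<beta>" "(norm (x - p))\<^sup>2" "(x - p) \<bullet> d"]
    have "(1 - u) * F p + u * F y + L / 2 * (u * (1 - u) * (norm d)\<^sup>2)
          + 1 / (2 * \<beta>) * ((norm (x - p))\<^sup>2 - u * (2 * ((x - p) \<bullet> d)) + u * (u * (norm d)\<^sup>2))
          - (F p + 1 / (2 * \<beta>) * (norm (x - p))\<^sup>2)
        = u * (F y - F p + L / 2 * ((1 - u) * (norm d)\<^sup>2) + 1 / (2 * \<beta>) * (u * (norm d)\<^sup>2) - 1 / \<beta> * ((x - p) \<bullet> d))"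
      by (simp add: mult.commute)
    ultimately have "0 \<le> u * (F y - F p + L / 2 * ((1 - u) * (norm d)\<^sup>2) + 1 / (2 * \<beta>) * (u * (norm d)\<^sup>2) - 1 / \<beta> * ((x - p) \<bullet> d))"
      by linarith
    then show ?thesis using u by (simp add: zero_le_mult_iff)
  qed
  have "1 / \<beta> * ((x - p) \<bullet> d) \<le> F y - F p + L / 2 * ((1 - 0) * (norm d)\<^sup>2) + 1 / (2 * \<beta>) * (0 * (norm d)\<^sup>2)"
  proof (rule tendsto_lowerbound)
    show "((\<lambda>u. F y - F p + L / 2 * ((1 - u) * (norm d)\<^sup>2) + 1 / (2 * \<beta>) * (u * (norm d)\<^sup>2)) \<longlongrightarrow>
       F y - F p + L / 2 * ((1 - 0) * (norm d)\<^sup>2) + 1 / (2 * \<beta>) * (0 * (norm d)\<^sup>2)) (at_right (0::real))"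
      by (intro tendsto_intros)
    show "\<forall>\<^sub>F u in at_right 0. 1 / \<beta> * ((x - p) \<bullet> d)
        \<le> F y - F p + L / 2 * ((1 - u) * (norm d)\<^sup>2) + 1 / (2 * \<beta>) * (u * (norm d)\<^sup>2)"
      using ineq by (auto simp: eventually_at_right_field intro!: exI[of _ 1])
  qed simp
  then show "(1 / \<beta>) *\<^sub>R (x - p) \<bullet> (y - p) \<le> F y - F p + L / 2 * (norm (y - p))\<^sup>2"
    by (simp add: d_def)
qed

text \<open>The resolvent relation \<open>(x - p) / \<beta> \<in> subdiff L F p\<close> determines \<open>p\<close> from \<open>x\<close> in a Lipschitz way when
\<open>\<beta> * L < 1\<close>; in particular proximal points are unique.\<close>

lemma resolvent_lipschitz:
  fixes x p :: "'a::real_inner"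
  assumes "0 < \<beta>" and p: "(1 / \<beta>) *\<^sub>R (x - p) \<in> subdiff L F p" and q: "(1 / \<beta>) *\<^sub>R (y - q) \<in> subdiff L F q"
  shows "(1 - \<beta> * L) * norm (p - q) \<le> norm (x - y)"
proof (cases "p = q")
  case False
  have "- L * (norm (p - q))\<^sup>2 \<le> ((1 / \<beta>) *\<^sub>R (x - p) - (1 / \<beta>) *\<^sub>R (y - q)) \<bullet> (p - q)"
    by (rule subdiff_hypomonotone[OF p q])
  also have "(1 / \<beta>) *\<^sub>R (x - p) - (1 / \<beta>) *\<^sub>R (y - q) = (1 / \<beta>) *\<^sub>R ((x - y) - (p - q))"
    by (simp add: algebra_simps)
  also have "\<dots> \<bullet> (p - q) = (1 / \<beta>) * ((x - y) \<bullet> (p - q) - (norm (p - q))\<^sup>2)"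
    by (simp only: inner_scaleR_left inner_diff_left[of "x - y"] power2_norm_eq_inner)
  finally have "\<beta> * (- L * (norm (p - q))\<^sup>2) \<le> (x - y) \<bullet> (p - q) - (norm (p - q))\<^sup>2"
    using \<open>0 < \<beta>\<close> by (simp add: field_simps)
  then have "(1 - \<beta> * L) * (norm (p - q))\<^sup>2 \<le> (x - y) \<bullet> (p - q)"
    by (simp add: algebra_simps)
  also have "\<dots> \<le> norm (x - y) * norm (p - q)" by (rule norm_cauchy_schwarz)
  finally have "((1 - \<beta> * L) * norm (p - q)) * norm (p - q) \<le> norm (x - y) * norm (p - q)"
    by (simp add: power2_eq_square mult.assoc)
  then show ?thesis using False by simp
qed simp

lemma one_le_one_minus_mult_exp:
  fixes s :: real
  assumes "0 \<le> s" "s \<le> 1 / 2"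
  shows "1 \<le> (1 - s) * exp (2 * s)"
proof -
  have "1 \<le> (1 - s) * (1 + 2 * s)"
    using mult_left_mono[OF assms(2), of "2 * s"] assms by (simp add: algebra_simps)
  also have "\<dots> \<le> (1 - s) * exp (2 * s)"
    using assms by (intro mult_left_mono exp_ge_add_one_self) auto
  finally show ?thesis .
qed

text \<open>From here on \<open>F\<close> is a fixed weakly convex function with nonnegative modulus. The
quantitative estimates assume \<open>\<beta> * L \<le> 1 / 2\<close>, since then \<open>1 / (1 - \<beta> * L) \<le> exp (2 * L * \<beta>)\<close>, and
exponential factors multiply well under iteration.\<close>

locale weakly_convex_function =
  fixes F :: "'a::euclidean_space \<Rightarrow> real" and L :: real
  assumes F: "weakly_convex L F" and L: "0 \<le> L"
begin

lemma prox_step_bound: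
  obtains K where "K \<ge> 0" "\<And>\<beta> z. 0 < \<beta> \<Longrightarrow> \<beta> * L < 1 \<Longrightarrow>
    F z + 1 / (2 * \<beta>) * (norm (x - z))\<^sup>2 \<le> F x \<Longrightarrow> norm (x - z) \<le> 2 * K * \<beta> / (1 - \<beta> * L)"
proof -
  obtain K where "K \<ge> 0" and K: "\<And>p. F x - K * norm (p - x) - L / 2 * (norm (p - x))\<^sup>2 \<le> F p"
    using weakly_convex_lower_bound[OF F] by metis
  have "norm (x - z) \<le> 2 * K * \<beta> / (1 - \<beta> * L)"
    if \<beta>: "0 < \<beta>" "\<beta> * L < 1" and z: "F z + 1 / (2 * \<beta>) * (norm (x - z))\<^sup>2 \<le> F x" for \<beta> z
  proof (cases "z = x")
    case True
    then show ?thesis using \<beta> \<open>K \<ge> 0\<close> by simp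
  next
    case False
    define s where "s = norm (x - z)"
    have s: "s > 0" using False by (simp add: s_def)
    have "1 / (2 * \<beta>) * s\<^sup>2 \<le> K * s + L / 2 * s\<^sup>2"
      using z K[of z] unfolding s_def norm_minus_commute[of z x] by linarith
    then have "2 * \<beta> * (1 / (2 * \<beta>) * s\<^sup>2) \<le> 2 * \<beta> * (K * s + L / 2 * s\<^sup>2)"
      using \<beta> by (intro mult_left_mono) auto
    then have "s\<^sup>2 \<le> 2 * \<beta> * (K * s + L / 2 * s\<^sup>2)" using \<beta> by simp
    then have "s * (s * (1 - \<beta> * L)) \<le> s * (2 * K * \<beta>)"
      by (simp add: algebra_simps power2_eq_square)
    then have "s * (1 - \<beta> * L) \<le> 2 * K * \<beta>" using s by simp
    then show ?thesis using \<beta> by (simp add: s_def pos_le_divide_eq)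
  qed
  then show ?thesis using \<open>K \<ge> 0\<close> that by blast
qed

lemma ex1_prox:
  assumes \<beta>: "0 < \<beta>" "\<beta> * L < 1"
  shows "\<exists>!p. is_prox \<beta> F x p"
proof (rule ex_ex1I)
  define J where "J z = F z + 1 / (2 * \<beta>) * (norm (x - z))\<^sup>2" for z
  obtain K where "K \<ge> 0" and K: "\<And>z. J z \<le> F x \<Longrightarrow> norm (x - z) \<le> 2 * K * \<beta> / (1 - \<beta> * L)"
    using prox_step_bound[of x] \<beta> unfolding J_def by metis
  have Jx: "J x = F x" by (simp add: J_def)
  define R where "R = 2 * K * \<beta> / (1 - \<beta> * L)"
  have "R \<ge> 0" using \<beta> \<open>K \<ge> 0\<close> by (simp add: R_def)
  have "continuous_on (cball x R) J"
    unfolding J_def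
    by (intro continuous_intros continuous_on_subset[OF weakly_convex_imp_continuous_on[OF F]]) auto
  then obtain p where p: "p \<in> cball x R" "\<And>z. z \<in> cball x R \<Longrightarrow> J p \<le> J z"
    using continuous_attains_inf[of "cball x R" J] \<open>R \<ge> 0\<close> by fastforce
  have "J p \<le> J z" for z
  proof (cases "z \<in> cball x R")
    case False
    then have "\<not> J z \<le> F x" using K[of z] by (auto simp: R_def dist_norm)
    then have "J x < J z" using Jx by linarith
    moreover have "J p \<le> J x" using p(2)[of x] \<open>R \<ge> 0\<close> by simp
    ultimately show ?thesis by simp
  qed (rule p(2))
  then show "\<exists>p. is_prox \<beta> F x p"
    unfolding is_prox_def is_arg_min_def J_def by (auto simp: not_less)
next
  fix p q assume p: "is_prox \<beta> F x p" and q: "is_prox \<beta> F x q"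
  have "(1 - \<beta> * L) * norm (p - q) \<le> norm (x - x)"
    by (rule resolvent_lipschitz[OF \<beta>(1) is_prox_imp_subdiff[OF F \<beta>(1) p] is_prox_imp_subdiff[OF F \<beta>(1) q]])
  then show "p = q" using \<beta> by (simp add: mult_le_0_iff)
qed

lemma is_prox_prox:
  assumes "0 < \<beta>" "\<beta> * L < 1"
  shows "is_prox \<beta> F x (prox \<beta> F x)"
  unfolding prox_def by (rule theI'[OF ex1_prox[OF assms]])

lemma prox_subdiff:
  assumes "0 < \<beta>" "\<beta> * L < 1"
  shows "(1 / \<beta>) *\<^sub>R (x - prox \<beta> F x) \<in> subdiff L F (prox \<beta> F x)"
  by (rule is_prox_imp_subdiff[OF F assms(1) is_prox_prox[OF assms]])

lemma resolvent_lipschitz_exp: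
  assumes \<beta>: "0 < \<beta>" "\<beta> * L \<le> 1 / 2"
    and p: "(1 / \<beta>) *\<^sub>R (x - p) \<in> subdiff L F p" and q: "(1 / \<beta>) *\<^sub>R (y - q) \<in> subdiff L F q"
  shows "norm (p - q) \<le> exp (2 * L * \<beta>) * norm (x - y)"
proof -
  have "norm (p - q) \<le> ((1 - \<beta> * L) * exp (2 * (\<beta> * L))) * norm (p - q)"
    using mult_right_mono[OF one_le_one_minus_mult_exp[of "\<beta> * L"], of "norm (p - q)"] \<beta> L by simp
  also have "\<dots> = exp (2 * L * \<beta>) * ((1 - \<beta> * L) * norm (p - q))" by (simp add: ac_simps)
  also have "\<dots> \<le> exp (2 * L * \<beta>) * norm (x - y)"
    using resolvent_lipschitz[OF \<beta>(1) p q] by simp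
  finally show ?thesis .
qed

lemma prox_lipschitz:
  assumes \<beta>: "0 < \<beta>" "\<beta> * L \<le> 1 / 2"
  shows "norm (prox \<beta> F x - prox \<beta> F y) \<le> exp (2 * L * \<beta>) * norm (x - y)"
  using \<beta> by (intro resolvent_lipschitz_exp prox_subdiff) auto

text \<open>The point \<open>x\<close> itself is the resolvent of \<open>x + \<beta> w\<close> when \<open>w\<close> is a subgradient at \<open>x\<close>, so the length of a
proximal step is controlled by every subgradient at its starting point.\<close>

lemma prox_step_le:
  assumes \<beta>: "0 < \<beta>" "\<beta> * L \<le> 1 / 2" and w: "w \<in> subdiff L F x"
  shows "norm (prox \<beta> F x - x) \<le> exp (2 * L * \<beta>) * (\<beta> * norm w)"
proof -
  have "norm (prox \<beta> F x - x) \<le> exp (2 * L * \<beta>) * norm (x - (x + \<beta> *\<^sub>R w))"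
    using \<beta> w by (intro resolvent_lipschitz_exp prox_subdiff) auto
  then show ?thesis using \<beta> by simp
qed

text \<open>A subgradient at \<open>x\<close> arises as a limit of the subgradients \<open>(x - prox \<beta> F x) / \<beta>\<close> at nearby points.\<close>

lemma subdiff_nonempty: "subdiff L F x \<noteq> {}"
proof -
  obtain K where "K \<ge> 0" and K: "\<And>\<beta> z. 0 < \<beta> \<Longrightarrow> \<beta> * L < 1 \<Longrightarrow>
      F z + 1 / (2 * \<beta>) * (norm (x - z))\<^sup>2 \<le> F x \<Longrightarrow> norm (x - z) \<le> 2 * K * \<beta> / (1 - \<beta> * L)"
    using prox_step_bound[of x] by metis
  define \<beta> where "\<beta> n = 1 / (real n + 1 + 2 * L)" for n
  have \<beta>: "0 < \<beta> n" "\<beta> n * L \<le> 1 / 2" for n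
    using L by (auto simp: \<beta>_def field_simps add_nonneg_pos)
  have \<beta>0: "\<beta> \<longlonglongrightarrow> 0" unfolding \<beta>_def by real_asymp
  define y where "y n = prox (\<beta> n) F x" for n
  have step: "norm (x - y n) \<le> 4 * K * \<beta> n" for n
  proof -
    have lt: "\<beta> n * L < 1" using \<beta>(2)[of n] by simp
    have "F (y n) + 1 / (2 * \<beta> n) * (norm (x - y n))\<^sup>2 \<le> F x + 1 / (2 * \<beta> n) * (norm (x - x))\<^sup>2"
      using is_prox_prox[OF \<beta>(1) lt, of x] unfolding is_prox_def is_arg_min_def y_def by (meson not_less)
    then have "norm (x - y n) \<le> 2 * K * \<beta> n / (1 - \<beta> n * L)"
      using K[OF \<beta>(1) lt] by simp
    also have "\<dots> \<le> 2 * K * \<beta> n / (1 / 2)"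
      using \<beta>[of n] \<open>K \<ge> 0\<close> by (intro divide_left_mono) auto
    finally show ?thesis by simp
  qed
  have "(\<lambda>n. 4 * K * \<beta> n) \<longlonglongrightarrow> 4 * K * 0" by (intro tendsto_intros \<beta>0)
  then have "(\<lambda>n. x - y n) \<longlonglongrightarrow> 0"
    using step by (intro Lim_null_comparison[of "\<lambda>n. x - y n" "\<lambda>n. 4 * K * \<beta> n"]) auto
  then have "(\<lambda>n. x - (x - y n)) \<longlonglongrightarrow> x - 0" by (intro tendsto_intros)
  then have "y \<longlonglongrightarrow> x" by simp
  moreover have "(1 / \<beta> n) *\<^sub>R (x - y n) \<in> subdiff L F (y n)" for n
    unfolding y_def using \<beta>[of n] by (intro prox_subdiff) auto
  moreover have "norm ((1 / \<beta> n) *\<^sub>R (x - y n)) \<le> 4 * K" for n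
  proof -
    have "norm ((1 / \<beta> n) *\<^sub>R (x - y n)) = norm (x - y n) / \<beta> n"
      using \<beta>(1)[of n] by simp
    then show ?thesis
      using step[of n] \<beta>(1)[of n] by (simp only: pos_divide_le_eq)
  qed
  ultimately have "\<exists>w \<in> subdiff L F x. norm w \<le> 4 * K"
    by (intro subdiff_bounded_limit[OF weakly_convex_imp_continuous_on[OF F], of y _ "\<lambda>n. (1 / \<beta> n) *\<^sub>R (x - y n)" _ "\<lambda>_. 4 * K"])
      auto
  then show ?thesis by blast
qed

end

section \<open>The subgradient of least norm and the velocity of the proximal flow\<close>

context weakly_convex_function
begin

text \<open>The element of least norm of the subdifferential; minus this vector will be the velocity of the
flow.\<close>

definition min_subgrad :: "'a \<Rightarrow> 'a" where
  "min_subgrad x = closest_point (subdiff L F x) 0"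

lemma min_subgrad_in: "min_subgrad x \<in> subdiff L F x"
  unfolding min_subgrad_def using closest_point_exists(1)[OF closed_subdiff subdiff_nonempty] .

lemma min_subgrad_le: "w \<in> subdiff L F x \<Longrightarrow> norm (min_subgrad x) \<le> norm w"
  unfolding min_subgrad_def using closest_point_le[OF closed_subdiff, of w L F x 0] by (simp add: dist_norm)

lemma min_subgrad_unique:
  assumes "w \<in> subdiff L F x" "norm w \<le> norm (min_subgrad x)"
  shows "w = min_subgrad x"
  unfolding min_subgrad_def
  using assms min_subgrad_le[of _ x] 
  by (intro closest_point_unique convex_subdiff closed_subdiff) (force simp: dist_norm intro: order_trans)+

text \<open>Vectors that satisfy the subgradient inequality at \<open>x\<close> up to a vanishing error, and whose norms are
asymptotically no larger than that of the least-norm subgradient, converge to this subgradient. Both the velocity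
of the proximal map and the derivative of the flow are identified in this way. The filter is
arbitrary, so that one-sided and two-sided limits are covered together.\<close>

lemma tendsto_min_subgrad:
  assumes sub: "\<And>y e. 0 < e \<Longrightarrow> \<forall>\<^sub>F i in N. g i \<bullet> (y - x) \<le> F y - F x + L / 2 * (norm (y - x))\<^sup>2 + e"
    and nrm: "\<And>e. 0 < e \<Longrightarrow> \<forall>\<^sub>F i in N. norm (g i) \<le> norm (min_subgrad x) + e"
  shows "(g \<longlongrightarrow> min_subgrad x) N"
proof (rule tendstoI)
  fix e :: real assume "e > 0"
  define m where "m = min_subgrad x"
  \<comment> \<open>Every point of the compact set \<open>K\<close> violates one of the two conditions by a positive margin, hence has a neighbourhood that \<open>g\<close> eventually avoids.\<close>
  define K where "K = cball 0 (norm m + 1) - ball m e"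
  have "compact K" unfolding K_def by (intro compact_diff) auto
  moreover have "\<exists>U. open U \<and> k \<in> U \<and> (\<forall>\<^sub>F i in N. g i \<notin> U)" if "k \<in> K" for k
  proof (cases "k \<in> subdiff L F x")
    case True
    have "k \<noteq> m" using \<open>k \<in> K\<close> \<open>e > 0\<close> by (auto simp: K_def)
    then have lt: "norm m < norm k"
      using min_subgrad_unique[OF True] unfolding m_def by fastforce
    define \<eta> where "\<eta> = (norm k - norm m) / 2"
    have "\<eta> > 0" "norm m + \<eta> < norm k" using lt by (auto simp: \<eta>_def field_simps)
    moreover have "open {v::'a. norm m + \<eta> < norm v}" by (intro open_Collect_less continuous_intros)
    moreover have "\<forall>\<^sub>F i in N. g i \<notin> {v. norm m + \<eta> < norm v}"
      using nrm[OF \<open>\<eta> > 0\<close>] by eventually_elim (auto simp: m_def)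
    ultimately show ?thesis by blast
  next
    case False
    then obtain y where y: "F y - F x + L / 2 * (norm (y - x))\<^sup>2 < k \<bullet> (y - x)"
      by (auto simp: subdiff_iff not_le)
    define \<Phi> where "\<Phi> = F y - F x + L / 2 * (norm (y - x))\<^sup>2"
    define \<eta> where "\<eta> = (k \<bullet> (y - x) - \<Phi>) / 2"
    have "\<eta> > 0" "\<Phi> + \<eta> < k \<bullet> (y - x)" using y by (auto simp: \<eta>_def \<Phi>_def field_simps)
    moreover have "open {v::'a. \<Phi> + \<eta> < v \<bullet> (y - x)}" by (intro open_Collect_less continuous_intros)
    moreover have "\<forall>\<^sub>F i in N. g i \<notin> {v. \<Phi> + \<eta> < v \<bullet> (y - x)}"
      using sub[OF \<open>\<eta> > 0\<close>, of y] by eventually_elim (auto simp: \<Phi>_def)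
    ultimately show ?thesis by blast
  qed
  then have "K \<subseteq> \<Union>{U. open U \<and> (\<forall>\<^sub>F i in N. g i \<notin> U)}" by blast
  ultimately obtain T where T: "T \<subseteq> {U. open U \<and> (\<forall>\<^sub>F i in N. g i \<notin> U)}" "finite T" "K \<subseteq> \<Union>T"
    by (rule compactE) auto
  have "\<forall>\<^sub>F i in N. \<forall>U\<in>T. g i \<notin> U"
    using T by (intro eventually_ball_finite) auto
  moreover have "\<forall>\<^sub>F i in N. norm (g i) \<le> norm m + 1"
    using nrm[of 1] by (simp add: m_def)
  ultimately show "\<forall>\<^sub>F i in N. dist (g i) (min_subgrad x) < e"
  proof eventually_elim
    case (elim i)
    then have "g i \<notin> K" using T(3) by blast
    then show ?case using elim by (auto simp: K_def m_def dist_commute)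
  qed
qed

lemma eventually_small_step:
  "\<forall>\<^sub>F \<beta> in at_right 0. 0 < \<beta> \<and> \<beta> * L \<le> 1 / 2"
  unfolding eventually_at_right_field
proof (intro exI conjI allI impI)
  show "0 < 1 / (2 * (L + 1))" using L by simp
  fix \<beta> :: real assume b: "0 < \<beta>" "\<beta> < 1 / (2 * (L + 1))"
  then have "\<beta> * (L + 1) \<le> 1 / 2" using L by (simp add: field_simps)
  then show "\<beta> * L \<le> 1 / 2" using b by (simp add: algebra_simps)
qed

lemma prox_velocity_tendsto:
  "((\<lambda>\<beta>. (prox \<beta> F x - x) /\<^sub>R \<beta>) \<longlongrightarrow> - min_subgrad x) (at_right 0)"
proof -
  define m where "m = min_subgrad x"
  define q where "q \<beta> = prox \<beta> F x" for \<beta>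
  define g where "g \<beta> = (1 / \<beta>) *\<^sub>R (x - q \<beta>)" for \<beta>
  have ev: "\<forall>\<^sub>F \<beta> in at_right 0. g \<beta> \<in> subdiff L F (q \<beta>) \<and> norm (g \<beta>) \<le> exp (2 * L * \<beta>) * norm m
      \<and> norm (q \<beta> - x) \<le> exp (2 * L * \<beta>) * (\<beta> * norm m)"
    using eventually_small_step
  proof eventually_elim
    case (elim \<beta>)
    then have 1: "norm (q \<beta> - x) \<le> exp (2 * L * \<beta>) * (\<beta> * norm m)"
      unfolding q_def m_def by (intro prox_step_le min_subgrad_in) auto
    have "norm (g \<beta>) = norm (q \<beta> - x) / \<beta>"
      using elim by (simp add: g_def norm_minus_commute)
    moreover have "exp (2 * L * \<beta>) * (\<beta> * norm m) = (exp (2 * L * \<beta>) * norm m) * \<beta>"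
      by (simp only: ac_simps)
    ultimately have "norm (g \<beta>) \<le> exp (2 * L * \<beta>) * norm m"
      using 1 elim by (simp only: pos_divide_le_eq)
    moreover have "g \<beta> \<in> subdiff L F (q \<beta>)"
      unfolding g_def q_def using elim by (intro prox_subdiff) auto
    ultimately show ?case using 1 by simp
  qed
  have e1: "((\<lambda>\<beta>. exp (2 * L * \<beta>) * norm m) \<longlongrightarrow> exp (2 * L * 0) * norm m) (at_right 0)"
    by (intro tendsto_intros)
  have "((\<lambda>\<beta>. exp (2 * L * \<beta>) * (\<beta> * norm m)) \<longlongrightarrow> exp (2 * L * 0) * (0 * norm m)) (at_right 0)"
    by (intro tendsto_intros)
  then have lim0: "((\<lambda>\<beta>. exp (2 * L * \<beta>) * (\<beta> * norm m)) \<longlongrightarrow> 0) (at_right 0)" by simp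
  have "\<forall>\<^sub>F \<beta> in at_right 0. norm (q \<beta> - x) \<le> exp (2 * L * \<beta>) * (\<beta> * norm m)"
    using ev by eventually_elim simp
  then have "((\<lambda>\<beta>. q \<beta> - x) \<longlongrightarrow> 0) (at_right 0)"
    using lim0 by (rule Lim_null_comparison)
  then have "((\<lambda>\<beta>. (q \<beta> - x) + x) \<longlongrightarrow> 0 + x) (at_right 0)" by (intro tendsto_intros)
  then have q: "(q \<longlongrightarrow> x) (at_right 0)" by simp
  have Fq: "((\<lambda>\<beta>. F (q \<beta>)) \<longlongrightarrow> F x) (at_right 0)"
    using continuous_on_tendsto_compose[OF weakly_convex_imp_continuous_on[OF F] q] by simp
  have "(g \<longlongrightarrow> m) (at_right 0)"
    unfolding m_def
  proof (rule tendsto_min_subgrad)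
    fix y :: 'a and e :: real assume "e > 0"
    have "((\<lambda>\<beta>. F y - F (q \<beta>) + L / 2 * (norm (y - q \<beta>))\<^sup>2 + (exp (2 * L * \<beta>) * norm m) * norm (q \<beta> - x))
       \<longlongrightarrow> F y - F x + L / 2 * (norm (y - x))\<^sup>2 + (exp (2 * L * 0) * norm m) * norm (x - x)) (at_right 0)"
      by (intro tendsto_intros Fq q)
    moreover have "F y - F x + L / 2 * (norm (y - x))\<^sup>2 + (exp (2 * L * 0) * norm m) * norm (x - x)
       < F y - F x + L / 2 * (norm (y - x))\<^sup>2 + e" using \<open>e > 0\<close> by simp
    ultimately have "\<forall>\<^sub>F \<beta> in at_right 0. F y - F (q \<beta>) + L / 2 * (norm (y - q \<beta>))\<^sup>2 + (exp (2 * L * \<beta>) * norm m) * norm (q \<beta> - x)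
      < F y - F x + L / 2 * (norm (y - x))\<^sup>2 + e"
      by (rule order_tendstoD(2))
    then show "\<forall>\<^sub>F \<beta> in at_right 0. g \<beta> \<bullet> (y - x) \<le> F y - F x + L / 2 * (norm (y - x))\<^sup>2 + e"
      using ev
    proof eventually_elim
      case (elim \<beta>)
      have "g \<beta> \<bullet> (y - x) = g \<beta> \<bullet> (y - q \<beta>) + g \<beta> \<bullet> (q \<beta> - x)"
        by (simp add: inner_diff_right)
      also have "g \<beta> \<bullet> (y - q \<beta>) \<le> F y - F (q \<beta>) + L / 2 * (norm (y - q \<beta>))\<^sup>2"
        using elim by (simp add: subdiff_iff)
      also have "g \<beta> \<bullet> (q \<beta> - x) \<le> norm (g \<beta>) * norm (q \<beta> - x)" by (rule norm_cauchy_schwarz)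
      also have "\<dots> \<le> (exp (2 * L * \<beta>) * norm m) * norm (q \<beta> - x)"
        using elim by (intro mult_right_mono) auto
      finally show ?case using elim by linarith
    qed
  next
    fix e :: real assume "e > 0"
    then have "\<forall>\<^sub>F \<beta> in at_right 0. exp (2 * L * \<beta>) * norm m < norm m + e"
      by (intro order_tendstoD(2)[OF e1]) auto
    then show "\<forall>\<^sub>F \<beta> in at_right 0. norm (g \<beta>) \<le> norm (min_subgrad x) + e"
      using ev by eventually_elim (auto simp: m_def)
  qed
  then have "((\<lambda>\<beta>. - g \<beta>) \<longlongrightarrow> - m) (at_right 0)" by (rule tendsto_minus)
  moreover have "- g \<beta> = (prox \<beta> F x - x) /\<^sub>R \<beta>" for \<beta>
    by (simp add: g_def q_def inverse_eq_divide scaleR_diff_right)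
  ultimately show ?thesis by (simp add: m_def)
qed

lemma has_prox_velocity_iff: "has_prox_velocity F x v \<longleftrightarrow> v = - min_subgrad x"
proof -
  have "\<forall>\<^sub>F \<beta> in at_right 0. \<exists>!p. is_prox \<beta> F x p"
    using eventually_small_step by eventually_elim (auto intro!: ex1_prox)
  then show ?thesis
    unfolding has_prox_velocity_def
    using prox_velocity_tendsto[of x] tendsto_unique[OF trivial_limit_at_right_real] by blast
qed

end

section \<open>Limits of proximal iterations\<close>

lemma has_vector_derivative_withinI_tendsto:
  fixes x :: "real \<Rightarrow> 'a::real_normed_vector"
  assumes "((\<lambda>s. (1 / (s - t)) *\<^sub>R (x s - x t)) \<longlongrightarrow> v) (at t within S)"
  shows "(x has_vector_derivative v) (at t within S)"
proof -
  have "((\<lambda>s. norm ((1 / (s - t)) *\<^sub>R (x s - x t) - v)) \<longlongrightarrow> 0) (at t within S)"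
    using assms by (simp add: LIM_zero_iff tendsto_norm_zero_iff)
  moreover have "\<forall>\<^sub>F s in at t within S. norm ((1 / (s - t)) *\<^sub>R (x s - x t) - v)
      = norm (x s - x t - (s - t) *\<^sub>R v) / norm (s - t)"
  proof -
    have "norm ((1 / (s - t)) *\<^sub>R (x s - x t) - v) = norm (x s - x t - (s - t) *\<^sub>R v) / norm (s - t)"
      if "s \<noteq> t" for s
    proof -
      have "(1 / (s - t)) *\<^sub>R (x s - x t) - v = (1 / (s - t)) *\<^sub>R (x s - x t - (s - t) *\<^sub>R v)"
        using that by (simp add: scaleR_diff_right[of _ "x s - x t"])
      then show ?thesis by (simp add: divide_inverse mult.commute)
    qed
    then show ?thesis by (auto simp: eventually_at_filter)
  qed
  ultimately have "((\<lambda>s. norm (x s - x t - (s - t) *\<^sub>R v) / norm (s - t)) \<longlongrightarrow> 0) (at t within S)"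
    by (rule Lim_transform_eventually)
  then show ?thesis
    unfolding has_vector_derivative_def has_derivative_iff_norm
    by (simp add: bounded_linear_scaleR_left)
qed

context weakly_convex_function
begin

lemma iterate_lipschitz:
  assumes \<beta>: "0 < \<beta>" "\<beta> * L \<le> 1 / 2"
  shows "norm ((prox \<beta> F ^^ k) a - (prox \<beta> F ^^ k) b) \<le> exp (2 * L * (real k * \<beta>)) * norm (a - b)"
proof (induction k)
  case (Suc k)
  have "norm ((prox \<beta> F ^^ Suc k) a - (prox \<beta> F ^^ Suc k) b)
      \<le> exp (2 * L * \<beta>) * norm ((prox \<beta> F ^^ k) a - (prox \<beta> F ^^ k) b)"
    using prox_lipschitz[OF \<beta>] by simp
  also have "\<dots> \<le> exp (2 * L * \<beta>) * (exp (2 * L * (real k * \<beta>)) * norm (a - b))"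
    using Suc by (intro mult_left_mono) auto
  also have "\<dots> = exp (2 * L * (real (Suc k) * \<beta>)) * norm (a - b)"
    by (simp add: exp_add[symmetric] algebra_simps)
  finally show ?case .
qed simp

lemma iterate_step_le:
  assumes \<beta>: "0 < \<beta>" "\<beta> * L \<le> 1 / 2" and w: "w \<in> subdiff L F a"
  shows "norm ((prox \<beta> F ^^ Suc k) a - (prox \<beta> F ^^ k) a) \<le> exp (2 * L * (real (Suc k) * \<beta>)) * (\<beta> * norm w)"
proof -
  have "norm ((prox \<beta> F ^^ Suc k) a - (prox \<beta> F ^^ k) a) \<le> exp (2 * L * (real k * \<beta>)) * norm (prox \<beta> F a - a)"
    using iterate_lipschitz[OF \<beta>, of k "prox \<beta> F a" a] by (simp add: funpow_swap1)
  also have "\<dots> \<le> exp (2 * L * (real k * \<beta>)) * (exp (2 * L * \<beta>) * (\<beta> * norm w))"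
    by (intro mult_left_mono prox_step_le \<beta> w) auto
  also have "\<dots> = exp (2 * L * (real (Suc k) * \<beta>)) * (\<beta> * norm w)"
  proof -
    have "2 * L * (real (Suc k) * \<beta>) = 2 * L * (real k * \<beta>) + 2 * L * \<beta>" by (simp add: algebra_simps)
    then show ?thesis by (simp only: exp_add mult.assoc)
  qed
  finally show ?thesis .
qed

lemma iterate_displacement_le:
  assumes \<beta>: "0 < \<beta>" "\<beta> * L \<le> 1 / 2" and w: "w \<in> subdiff L F a"
  shows "norm ((prox \<beta> F ^^ k) a - a) \<le> real k * \<beta> * exp (2 * L * (real k * \<beta>)) * norm w"
proof (induction k)
  case (Suc k)
  define E where "E = exp (2 * L * (real (Suc k) * \<beta>))"
  have "exp (2 * L * (real k * \<beta>)) \<le> E"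
    unfolding E_def using \<beta> L by (auto intro!: mult_left_mono mult_right_mono)
  then have "real k * \<beta> * exp (2 * L * (real k * \<beta>)) * norm w \<le> real k * \<beta> * E * norm w"
    using \<beta> by (intro mult_left_mono mult_right_mono) auto
  moreover have "norm ((prox \<beta> F ^^ Suc k) a - (prox \<beta> F ^^ k) a) \<le> E * (\<beta> * norm w)"
    unfolding E_def by (rule iterate_step_le[OF \<beta> w])
  moreover have "norm ((prox \<beta> F ^^ Suc k) a - a)
      \<le> norm ((prox \<beta> F ^^ Suc k) a - (prox \<beta> F ^^ k) a) + norm ((prox \<beta> F ^^ k) a - a)"
    using norm_triangle_ineq[of "(prox \<beta> F ^^ Suc k) a - (prox \<beta> F ^^ k) a" "(prox \<beta> F ^^ k) a - a"] by simp
  ultimately have "norm ((prox \<beta> F ^^ Suc k) a - a) \<le> E * (\<beta> * norm w) + real k * \<beta> * E * norm w"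
    using Suc by linarith
  also have "\<dots> = real (Suc k) * \<beta> * E * norm w" by (simp add: algebra_simps)
  finally show ?case unfolding E_def .
qed simp

text \<open>A curve \<open>x\<close> is a limit of proximal iterations when, for \<open>s \<le> t\<close>, the value \<open>x t\<close> is the limit of
iterates that are started exactly at \<open>x s\<close> and whose total step length tends to \<open>t - s\<close>. Restarting
at \<open>x s\<close> is what makes the estimates below sharp at every time, and not just at time 0.\<close>

definition prox_limit_curve :: "(nat \<Rightarrow> real) \<Rightarrow> (real \<Rightarrow> 'a) \<Rightarrow> bool" where
  "prox_limit_curve \<beta> x \<longleftrightarrow>
     (\<forall>n. 0 < \<beta> n \<and> \<beta> n * L \<le> 1 / 2) \<and> \<beta> \<longlonglongrightarrow> 0 \<and>
     (\<forall>s t. 0 \<le> s \<longrightarrow> s \<le> t \<longrightarrow> (\<exists>k. (\<lambda>n. real (k n) * \<beta> n) \<longlonglongrightarrow> t - s \<and>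
        (\<lambda>n. (prox (\<beta> n) F ^^ k n) (x s)) \<longlonglongrightarrow> x t))"

lemma prox_limit_curveE:
  assumes "prox_limit_curve \<beta> x" "0 \<le> s" "s \<le> t"
  obtains k where "\<And>n. 0 < \<beta> n" "\<And>n. \<beta> n * L \<le> 1 / 2" "(\<lambda>n. real (k n) * \<beta> n) \<longlonglongrightarrow> t - s"
    "(\<lambda>n. (prox (\<beta> n) F ^^ k n) (x s)) \<longlonglongrightarrow> x t"
  using assms unfolding prox_limit_curve_def by meson

lemma limit_curve_displacement_le:
  assumes x: "prox_limit_curve \<beta> x" and st: "0 \<le> s" "s \<le> t" and w: "w \<in> subdiff L F (x s)"
  shows "norm (x t - x s) \<le> (t - s) * exp (2 * L * (t - s)) * norm w"
proof -
  obtain k where k: "\<And>n. 0 < \<beta> n" "\<And>n. \<beta> n * L \<le> 1 / 2" "(\<lambda>n. real (k n) * \<beta> n) \<longlonglongrightarrow> t - s"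
    "(\<lambda>n. (prox (\<beta> n) F ^^ k n) (x s)) \<longlonglongrightarrow> x t"
    using prox_limit_curveE[OF x st] by metis
  show ?thesis
  proof (rule LIMSEQ_le)
    show "(\<lambda>n. norm ((prox (\<beta> n) F ^^ k n) (x s) - x s)) \<longlonglongrightarrow> norm (x t - x s)"
      by (intro tendsto_intros k)
    show "(\<lambda>n. real (k n) * \<beta> n * exp (2 * L * (real (k n) * \<beta> n)) * norm w) \<longlonglongrightarrow> (t - s) * exp (2 * L * (t - s)) * norm w"
      by (intro tendsto_intros k)
    show "\<exists>N. \<forall>n\<ge>N. norm ((prox (\<beta> n) F ^^ k n) (x s) - x s)
       \<le> real (k n) * \<beta> n * exp (2 * L * (real (k n) * \<beta> n)) * norm w"
      using iterate_displacement_le[OF k(1,2) w] by blast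
  qed
qed

text \<open>The speed can grow at most exponentially: \<open>exp (- 2 * L * t)\<close> times the least subgradient norm is
nonincreasing along the curve.\<close>

lemma limit_curve_min_subgrad_le:
  assumes x: "prox_limit_curve \<beta> x" and st: "0 \<le> s" "s \<le> t"
  shows "norm (min_subgrad (x t)) \<le> exp (2 * L * (t - s)) * norm (min_subgrad (x s))"
proof (cases "s = t")
  case False
  then have "0 < t - s" using st by simp
  obtain k where k: "\<And>n. 0 < \<beta> n" "\<And>n. \<beta> n * L \<le> 1 / 2" "(\<lambda>n. real (k n) * \<beta> n) \<longlonglongrightarrow> t - s"
    "(\<lambda>n. (prox (\<beta> n) F ^^ k n) (x s)) \<longlonglongrightarrow> x t"
    using prox_limit_curveE[OF x st] by metis
  define m where "m = min_subgrad (x s)"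
  define g where "g n = (1 / \<beta> n) *\<^sub>R ((prox (\<beta> n) F ^^ (k n - 1)) (x s) - (prox (\<beta> n) F ^^ k n) (x s))" for n
  have pos: "\<forall>\<^sub>F n in sequentially. 0 < k n"
    using order_tendstoD(1)[OF k(3) \<open>0 < t - s\<close>] by eventually_elim (auto intro: gr0I)
  have "\<exists>w \<in> subdiff L F (x t). norm w \<le> exp (2 * L * (t - s)) * norm m"
  proof (rule subdiff_bounded_limit[OF weakly_convex_imp_continuous_on[OF F] k(4)])
    show "\<forall>\<^sub>F n in sequentially. g n \<in> subdiff L F ((prox (\<beta> n) F ^^ k n) (x s))"
      using pos
    proof eventually_elim
      case (elim n)
      then obtain j where j: "k n = Suc j" using gr0_implies_Suc by blast
      show ?case
        unfolding g_def j using prox_subdiff[of "\<beta> n" "(prox (\<beta> n) F ^^ j) (x s)"] k(1,2)[of n] by simp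
    qed
    show "\<forall>\<^sub>F n in sequentially. norm (g n) \<le> exp (2 * L * (real (k n) * \<beta> n)) * norm m"
      using pos
    proof eventually_elim
      case (elim n)
      then obtain j where j: "k n = Suc j" using gr0_implies_Suc by blast
      have "norm (g n) = norm ((prox (\<beta> n) F ^^ Suc j) (x s) - (prox (\<beta> n) F ^^ j) (x s)) / \<beta> n"
        unfolding g_def j using k(1)[of n] by (simp add: norm_minus_commute)
      also have "\<dots> \<le> exp (2 * L * (real (Suc j) * \<beta> n)) * (\<beta> n * norm m) / \<beta> n"
        unfolding m_def using k(1)[of n]
        by (intro divide_right_mono iterate_step_le k min_subgrad_in) auto
      also have "\<dots> = exp (2 * L * (real (k n) * \<beta> n)) * norm m"
        unfolding j using k(1)[of n] by simp
      finally show ?case .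
    qed
    show "(\<lambda>n. exp (2 * L * (real (k n) * \<beta> n)) * norm m) \<longlonglongrightarrow> exp (2 * L * (t - s)) * norm m"
      by (intro tendsto_intros k)
  qed
  then show ?thesis
    using min_subgrad_le unfolding m_def by (meson order_trans)
qed simp

lemma limit_curve_min_subgrad_bound:
  assumes x: "prox_limit_curve \<beta> x" and "0 \<le> s" "s \<le> T"
  shows "norm (min_subgrad (x s)) \<le> exp (2 * L * T) * norm (min_subgrad (x 0))"
proof -
  have "norm (min_subgrad (x s)) \<le> exp (2 * L * (s - 0)) * norm (min_subgrad (x 0))"
    using assms by (intro limit_curve_min_subgrad_le) auto
  also have "\<dots> \<le> exp (2 * L * T) * norm (min_subgrad (x 0))"
    using assms L by (intro mult_right_mono) (auto intro: mult_left_mono)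
  finally show ?thesis .
qed

lemma limit_curve_lipschitz:
  assumes x: "prox_limit_curve \<beta> x" and "0 \<le> T"
  obtains C where "C > 0" "\<And>s t. 0 \<le> s \<Longrightarrow> s \<le> t \<Longrightarrow> t \<le> T \<Longrightarrow> norm (x t - x s) \<le> C * (t - s)"
proof
  define M where "M = exp (2 * L * T) * norm (min_subgrad (x 0))"
  have "M \<ge> 0" by (simp add: M_def)
  show "exp (2 * L * T) * M + 1 > 0" using \<open>M \<ge> 0\<close> by (simp add: add_nonneg_pos)
  fix s t assume st: "0 \<le> s" "s \<le> t" "t \<le> T"
  have "norm (x t - x s) \<le> (t - s) * exp (2 * L * (t - s)) * norm (min_subgrad (x s))"
    using st by (intro limit_curve_displacement_le[OF x] min_subgrad_in) auto
  also have "\<dots> \<le> (t - s) * exp (2 * L * T) * M"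
    unfolding M_def using st L
    by (intro mult_mono limit_curve_min_subgrad_bound[OF x]) (auto intro!: mult_left_mono)
  also have "\<dots> \<le> (exp (2 * L * T) * M + 1) * (t - s)"
    using st by (simp add: algebra_simps)
  finally show "norm (x t - x s) \<le> (exp (2 * L * T) * M + 1) * (t - s)" .
qed

lemma iterate_variational_ineq:
  assumes "\<And>j. j < k \<Longrightarrow> ((1 / \<beta>) *\<^sub>R ((prox \<beta> F ^^ j) a - (prox \<beta> F ^^ Suc j) a)) \<bullet> v \<le> M" and "0 < \<beta>"
  shows "(a - (prox \<beta> F ^^ k) a) \<bullet> v \<le> real k * \<beta> * M"
  using assms(1)
proof (induction k)
  case (Suc k)
  have "(a - (prox \<beta> F ^^ k) a) \<bullet> v \<le> real k * \<beta> * M"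
    using Suc.prems by (intro Suc.IH) auto
  moreover have "((prox \<beta> F ^^ k) a - (prox \<beta> F ^^ Suc k) a) \<bullet> v \<le> \<beta> * M"
  proof -
    have "1 / \<beta> * (((prox \<beta> F ^^ k) a - (prox \<beta> F ^^ Suc k) a) \<bullet> v) \<le> M"
      using Suc.prems[of k] by (simp only: inner_scaleR_left)
    then show ?thesis using \<open>0 < \<beta>\<close> by (simp add: pos_divide_le_eq mult.commute)
  qed
  moreover have "(a - (prox \<beta> F ^^ Suc k) a) \<bullet> v
      = (a - (prox \<beta> F ^^ k) a) \<bullet> v + ((prox \<beta> F ^^ k) a - (prox \<beta> F ^^ Suc k) a) \<bullet> v"
    by (simp add: inner_diff_left)
  ultimately show ?case by (simp add: algebra_simps)
qed simp

text \<open>Locally around time \<open>r\<close>, the difference quotients of \<open>- x\<close> satisfy the subgradient inequality at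
\<open>x r\<close> up to an error \<open>e\<close>. On the discrete level, each step is \<open>- \<beta>\<close> times a subgradient at its end
point, and all iterates involved stay close to \<open>x r\<close>.\<close>

lemma limit_curve_variational_ineq:
  assumes x: "prox_limit_curve \<beta> x" and "0 \<le> r" and "0 < e"
  obtains \<delta> where "\<delta> > 0" "\<And>s t. 0 \<le> s \<Longrightarrow> s \<le> t \<Longrightarrow> \<bar>s - r\<bar> < \<delta> \<Longrightarrow> \<bar>t - r\<bar> < \<delta> \<Longrightarrow>
    (x s - x t) \<bullet> (y - x r) \<le> (t - s) * (F y - F (x r) + L / 2 * (norm (y - x r))\<^sup>2 + e)"
proof -
  define \<Phi> where "\<Phi> z = F y - F z + L / 2 * (norm (y - z))\<^sup>2" for z
  define T where "T = r + 1"
  have "1 \<le> T" using \<open>0 \<le> r\<close> by (simp add: T_def)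
  obtain C where "C > 0" and C: "\<And>s t. 0 \<le> s \<Longrightarrow> s \<le> t \<Longrightarrow> t \<le> T \<Longrightarrow> norm (x t - x s) \<le> C * (t - s)"
    using limit_curve_lipschitz[OF x, of T] \<open>1 \<le> T\<close> by auto
  define M where "M = exp (2 * L * T) * (exp (2 * L * T) * norm (min_subgrad (x 0))) + C"
  have "M > 0" "C \<le> M" using \<open>C > 0\<close> by (auto simp: M_def add_nonneg_pos)
  have "isCont \<Phi> (x r)"
    unfolding \<Phi>_def using weakly_convex_imp_continuous_on[OF F]
    by (intro continuous_intros) (simp add: continuous_on_eq_continuous_at)
  then obtain \<rho>' where "\<rho>' > 0" and \<rho>': "\<And>z. dist z (x r) < \<rho>' \<Longrightarrow> dist (\<Phi> z) (\<Phi> (x r)) < e / 2"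
    using \<open>0 < e\<close> unfolding continuous_at_eps_delta by (metis half_gt_zero)
  define \<rho> where "\<rho> = min \<rho>' (e / (2 * M))"
  have "\<rho> > 0" using \<open>\<rho>' > 0\<close> \<open>M > 0\<close> \<open>0 < e\<close> by (simp add: \<rho>_def)
  have "M * \<rho> \<le> e / 2"
  proof -
    have "M * \<rho> \<le> M * (e / (2 * M))" using \<open>M > 0\<close> by (intro mult_left_mono) (auto simp: \<rho>_def)
    then show ?thesis using \<open>M > 0\<close> by simp
  qed
  \<comment> \<open>The iterates start within \<open>M * \<delta>\<close> of \<open>x r\<close> and move by at most \<open>M * (3 * \<delta>)\<close>, since their total step length is eventually below \<open>3 * \<delta>\<close>.\<close>
  define \<delta> where "\<delta> = min (1 / 3) (\<rho> / (4 * M))"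
  have "\<delta> > 0" "\<delta> \<le> 1 / 3" using \<open>\<rho> > 0\<close> \<open>M > 0\<close> by (auto simp: \<delta>_def)
  have \<delta>\<rho>: "M * (4 * \<delta>) \<le> \<rho>"
  proof -
    have "M * (4 * \<delta>) \<le> M * (4 * (\<rho> / (4 * M)))" using \<open>M > 0\<close> by (intro mult_left_mono) (auto simp: \<delta>_def)
    then show ?thesis using \<open>M > 0\<close> by simp
  qed
  have "(x s - x t) \<bullet> (y - x r) \<le> (t - s) * (\<Phi> (x r) + e)"
    if st: "0 \<le> s" "s \<le> t" "\<bar>s - r\<bar> < \<delta>" "\<bar>t - r\<bar> < \<delta>" for s t
  proof -
    obtain k where k: "\<And>n. 0 < \<beta> n" "\<And>n. \<beta> n * L \<le> 1 / 2" "(\<lambda>n. real (k n) * \<beta> n) \<longlonglongrightarrow> t - s"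
      "(\<lambda>n. (prox (\<beta> n) F ^^ k n) (x s)) \<longlonglongrightarrow> x t"
      using prox_limit_curveE[OF x st(1,2)] by metis
    define m where "m = min_subgrad (x s)"
    have sT: "s \<le> T" "r \<le> T" using st \<open>\<delta> \<le> 1 / 3\<close> by (auto simp: T_def)
    have m: "norm m \<le> exp (2 * L * T) * norm (min_subgrad (x 0))"
      unfolding m_def by (rule limit_curve_min_subgrad_bound[OF x st(1) sT(1)])
    have xs: "norm (x s - x r) < M * \<delta>"
    proof -
      have "norm (x s - x r) \<le> C * \<bar>s - r\<bar>"
        using C[of s r] C[of r s] st(1) \<open>0 \<le> r\<close> sT by (cases "s \<le> r") (auto simp: norm_minus_commute)
      also have "\<dots> \<le> M * \<bar>s - r\<bar>" using \<open>C \<le> M\<close> by (intro mult_right_mono) auto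
      also have "\<dots> < M * \<delta>" using st \<open>M > 0\<close> by simp
      finally show ?thesis .
    qed
    have bound: "exp (2 * L * h) * norm m \<le> M" if "h \<le> T" for h
    proof -
      have "exp (2 * L * h) * norm m \<le> exp (2 * L * T) * (exp (2 * L * T) * norm (min_subgrad (x 0)))"
        using that L m by (intro mult_mono) (auto intro: mult_left_mono)
      then show ?thesis using \<open>C > 0\<close> by (simp add: M_def)
    qed
    have step: "((1 / \<beta> n) *\<^sub>R ((prox (\<beta> n) F ^^ j) (x s) - (prox (\<beta> n) F ^^ Suc j) (x s))) \<bullet> (y - x r) \<le> \<Phi> (x r) + e"
      if j: "real (Suc j) * \<beta> n \<le> 3 * \<delta>" for n j
    proof -
      define p where "p = (prox (\<beta> n) F ^^ Suc j) (x s)"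
      define g where "g = (1 / \<beta> n) *\<^sub>R ((prox (\<beta> n) F ^^ j) (x s) - p)"
      define h where "h = real (Suc j) * \<beta> n"
      have h: "0 \<le> h" "h \<le> 3 * \<delta>" "h \<le> T" 
        using j k(1)[of n] \<open>\<delta> \<le> 1 / 3\<close> \<open>1 \<le> T\<close> by (auto simp: h_def intro!: mult_nonneg_nonneg)
      have g_in: "g \<in> subdiff L F p"
        unfolding g_def p_def using prox_subdiff[of "\<beta> n" "(prox (\<beta> n) F ^^ j) (x s)"] k(1,2)[of n] by simp
      have "norm g = norm (p - (prox (\<beta> n) F ^^ j) (x s)) / \<beta> n"
        unfolding g_def using k(1)[of n] by (simp add: norm_minus_commute)
      also have "\<dots> \<le> exp (2 * L * h) * (\<beta> n * norm m) / \<beta> n"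
        unfolding m_def h_def p_def using k(1)[of n]
        by (intro divide_right_mono iterate_step_le k min_subgrad_in) auto
      also have "\<dots> = exp (2 * L * h) * norm m" using k(1)[of n] by simp
      also have "\<dots> \<le> M" by (rule bound[OF h(3)])
      finally have g: "norm g \<le> M" .
      have "norm (p - x s) \<le> h * exp (2 * L * h) * norm m"
        unfolding p_def h_def m_def by (intro iterate_displacement_le k min_subgrad_in)
      also have "\<dots> = h * (exp (2 * L * h) * norm m)" by simp
      also have "\<dots> \<le> 3 * \<delta> * M"
        using h bound[OF h(3)] \<open>M > 0\<close> by (intro mult_mono) auto
      finally have "norm (p - x r) < M * (4 * \<delta>)"
        using xs norm_triangle_ineq[of "p - x s" "x s - x r"] by (simp add: algebra_simps)
      then have pr: "norm (p - x r) < \<rho>" using \<delta>\<rho> by simp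
      then have "\<Phi> p < \<Phi> (x r) + e / 2"
        using \<rho>'[of p] unfolding \<rho>_def dist_norm dist_real_def real_norm_def by linarith
      moreover have "g \<bullet> (y - x r) = g \<bullet> (y - p) + g \<bullet> (p - x r)"
        by (simp add: inner_diff_right)
      moreover have "g \<bullet> (y - p) \<le> \<Phi> p" using g_in by (simp add: subdiff_iff \<Phi>_def)
      moreover have "g \<bullet> (p - x r) \<le> M * \<rho>"
        using norm_cauchy_schwarz[of g "p - x r"] mult_mono[OF g less_imp_le[OF pr]] \<open>M > 0\<close> by simp
      ultimately show ?thesis using \<open>M * \<rho> \<le> e / 2\<close> unfolding g_def p_def by linarith
    qed
    have "t - s < 3 * \<delta>" using st by linarith
    from order_tendstoD(2)[OF k(3) this]
    have "\<forall>\<^sub>F n in sequentially. (x s - (prox (\<beta> n) F ^^ k n) (x s)) \<bullet> (y - x r) \<le> real (k n) * \<beta> n * (\<Phi> (x r) + e)"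
    proof eventually_elim
      case (elim n)
      show ?case
      proof (rule iterate_variational_ineq[OF step k(1)])
        fix j assume "j < k n"
        then have "real (Suc j) * \<beta> n \<le> real (k n) * \<beta> n"
          using k(1)[of n] by (intro mult_right_mono) auto
        then show "real (Suc j) * \<beta> n \<le> 3 * \<delta>" using elim by linarith
      qed
    qed
    moreover have "(\<lambda>n. (x s - (prox (\<beta> n) F ^^ k n) (x s)) \<bullet> (y - x r)) \<longlonglongrightarrow> (x s - x t) \<bullet> (y - x r)"
      by (intro tendsto_intros k)
    moreover have "(\<lambda>n. real (k n) * \<beta> n * (\<Phi> (x r) + e)) \<longlonglongrightarrow> (t - s) * (\<Phi> (x r) + e)"
      by (intro tendsto_intros k)
    ultimately show ?thesis
      by (intro tendsto_le[OF trivial_limit_sequentially])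
  qed
  then show ?thesis using that \<open>\<delta> > 0\<close> unfolding \<Phi>_def by blast
qed

end

section \<open>Existence of solutions\<close>

context weakly_convex_function
begin

text \<open>To the right of \<open>t\<close> the difference quotients are bounded by the least subgradient norm at time \<open>t\<close>
up to a factor tending to 1. To the left the bound involves that norm at the earlier time, which
is why continuity of the least norm along the curve is required.\<close>

lemma limit_curve_has_vector_derivative:
  assumes x: "prox_limit_curve \<beta> x" and t: "0 \<le> t"
    and cont: "continuous (at t within {0..}) (\<lambda>s. norm (min_subgrad (x s)))"
  shows "(x has_vector_derivative - min_subgrad (x t)) (at t within {0..})"
proof (rule has_vector_derivative_withinI_tendsto)
  define m where "m s = min_subgrad (x s)" for s
  define g where "g s = (1 / (s - t)) *\<^sub>R (x t - x s)" for s
  have "(g \<longlongrightarrow> min_subgrad (x t)) (at t within {0..})"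
  proof (rule tendsto_min_subgrad)
    fix y :: 'a and e :: real assume "0 < e"
    then obtain \<delta> where "\<delta> > 0" and \<delta>: "\<And>r s. 0 \<le> r \<Longrightarrow> r \<le> s \<Longrightarrow> \<bar>r - t\<bar> < \<delta> \<Longrightarrow> \<bar>s - t\<bar> < \<delta> \<Longrightarrow>
      (x r - x s) \<bullet> (y - x t) \<le> (s - r) * (F y - F (x t) + L / 2 * (norm (y - x t))\<^sup>2 + e)"
      using limit_curve_variational_ineq[OF x t] by metis
    define \<Phi> where "\<Phi> = F y - F (x t) + L / 2 * (norm (y - x t))\<^sup>2 + e"
    have "g s \<bullet> (y - x t) \<le> \<Phi>" if "0 \<le> s" "s \<noteq> t" "\<bar>s - t\<bar> < \<delta>" for s
    proof (cases "t < s")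
      case True
      then have "(x t - x s) \<bullet> (y - x t) \<le> \<Phi> * (s - t)"
        using \<delta>[of t s] that t \<open>\<delta> > 0\<close> unfolding \<Phi>_def[symmetric] by (simp add: mult.commute)
      then show ?thesis
        using True by (simp add: g_def pos_divide_le_eq)
    next
      case False
      then have "s < t" using that by simp
      then have "(x s - x t) \<bullet> (y - x t) \<le> \<Phi> * (t - s)"
        using \<delta>[of s t] that t \<open>\<delta> > 0\<close> unfolding \<Phi>_def[symmetric] by (simp add: mult.commute)
      moreover have "g s = (1 / (t - s)) *\<^sub>R (x s - x t)"
      proof -
        have "1 / (s - t) = - (1 / (t - s))" by (simp add: minus_divide_right)
        then show ?thesis
          unfolding g_def by (simp only: scaleR_minus_left scaleR_minus_right[symmetric] minus_diff_eq)
      qed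
      ultimately show ?thesis
        using \<open>s < t\<close> by (simp add: pos_divide_le_eq)
    qed
    then show "\<forall>\<^sub>F s in at t within {0..}. g s \<bullet> (y - x t) \<le> F y - F (x t) + L / 2 * (norm (y - x t))\<^sup>2 + e"
      unfolding eventually_at \<Phi>_def using \<open>\<delta> > 0\<close> by (auto simp: dist_real_def intro!: exI[of _ \<delta>])
  next
    fix e :: real assume "0 < e"
    have g: "norm (g s) \<le> exp (2 * L * \<bar>s - t\<bar>) * max (norm (m t)) (norm (m s))" if "0 \<le> s" "s \<noteq> t" for s
    proof (cases "t < s")
      case True
      have "norm (x s - x t) \<le> (s - t) * exp (2 * L * (s - t)) * norm (m t)"
        unfolding m_def using True t by (intro limit_curve_displacement_le[OF x] min_subgrad_in) auto
      then have "norm (x s - x t) / (s - t) \<le> exp (2 * L * \<bar>s - t\<bar>) * norm (m t)"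
        using True by (simp add: pos_divide_le_eq ac_simps)
      also have "\<dots> \<le> exp (2 * L * \<bar>s - t\<bar>) * max (norm (m t)) (norm (m s))"
        by (intro mult_left_mono) auto
      finally show ?thesis
        using True by (simp add: g_def norm_minus_commute)
    next
      case False
      then have "s < t" using that by simp
      have "norm (x t - x s) \<le> (t - s) * exp (2 * L * (t - s)) * norm (m s)"
        unfolding m_def using \<open>s < t\<close> that by (intro limit_curve_displacement_le[OF x] min_subgrad_in) auto
      then have "norm (x t - x s) / (t - s) \<le> exp (2 * L * \<bar>s - t\<bar>) * norm (m s)"
        using \<open>s < t\<close> by (simp add: pos_divide_le_eq ac_simps)
      also have "\<dots> \<le> exp (2 * L * \<bar>s - t\<bar>) * max (norm (m t)) (norm (m s))"
        by (intro mult_left_mono) auto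
      finally show ?thesis
        using \<open>s < t\<close> by (simp add: g_def)
    qed
    have nm: "((\<lambda>s. norm (m s)) \<longlongrightarrow> norm (m t)) (at t within {0..})"
      using cont by (simp add: continuous_within m_def)
    have "((\<lambda>s. exp (2 * L * \<bar>s - t\<bar>) * max (norm (m t)) (norm (m s)))
       \<longlongrightarrow> exp (2 * L * \<bar>t - t\<bar>) * max (norm (m t)) (norm (m t))) (at t within {0..})"
      by (intro tendsto_mult tendsto_exp tendsto_max tendsto_rabs tendsto_diff tendsto_const tendsto_ident_at nm)
    then have "\<forall>\<^sub>F s in at t within {0..}. exp (2 * L * \<bar>s - t\<bar>) * max (norm (m t)) (norm (m s)) < norm (m t) + e"
      using \<open>0 < e\<close> by (intro order_tendstoD(2)) auto
    moreover have "\<forall>\<^sub>F s in at t within {0..}. 0 \<le> s \<and> s \<noteq> t"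
      by (simp add: eventually_at_filter)
    ultimately show "\<forall>\<^sub>F s in at t within {0..}. norm (g s) \<le> norm (min_subgrad (x t)) + e"
    proof eventually_elim
      case (elim s)
      then show ?case using g[of s] by (simp add: m_def)
    qed
  qed
  then have "((\<lambda>s. - g s) \<longlongrightarrow> - min_subgrad (x t)) (at t within {0..})" by (rule tendsto_minus)
  moreover have "- g s = (1 / (s - t)) *\<^sub>R (x s - x t)" for s
    unfolding g_def by (simp flip: scaleR_minus_right)
  ultimately show "((\<lambda>s. (1 / (s - t)) *\<^sub>R (x s - x t)) \<longlongrightarrow> - min_subgrad (x t)) (at t within {0..})"
    by simp
qed

text \<open>Along the curve, the least subgradient norm times \<open>exp (- 2 * L * t)\<close> is monotone, and a monotone
function has only countably many discontinuities.\<close>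

lemma limit_curve_countable_discont:
  assumes x: "prox_limit_curve \<beta> x"
  shows "countable {t \<in> {0..}. \<not> continuous (at t within {0..}) (\<lambda>s. norm (min_subgrad (x s)))}"
proof (rule countable_subset)
  define \<phi> where "\<phi> s = - (exp (- (2 * L * s)) * norm (min_subgrad (x s)))" for s
  have "mono_on {0..} \<phi>"
  proof (rule mono_onI)
    fix s t :: real assume st: "s \<in> {0..}" "t \<in> {0..}" "s \<le> t"
    have "exp (- (2 * L * t)) * norm (min_subgrad (x t))
        \<le> exp (- (2 * L * t)) * (exp (2 * L * (t - s)) * norm (min_subgrad (x s)))"
      using st by (intro mult_left_mono limit_curve_min_subgrad_le[OF x]) auto
    also have "\<dots> = (exp (- (2 * L * t)) * exp (2 * L * (t - s))) * norm (min_subgrad (x s))"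
      by simp
    also have "exp (- (2 * L * t)) * exp (2 * L * (t - s)) = exp (- (2 * L * s))"
      by (simp add: exp_add[symmetric] algebra_simps)
    finally show "\<phi> s \<le> \<phi> t" by (simp add: \<phi>_def)
  qed
  then show "countable {t \<in> {0..}. \<not> continuous (at t within {0..}) \<phi>}"
    by (rule mono_on_ctble_discont)
  have "continuous (at t within {0..}) (\<lambda>s. norm (min_subgrad (x s)))"
    if "continuous (at t within {0..}) \<phi>" for t
  proof -
    have "continuous (at t within {0..}) (\<lambda>s. - exp (2 * L * s) * \<phi> s)"
      by (intro continuous_intros that)
    moreover have "- exp (2 * L * s) * \<phi> s = norm (min_subgrad (x s))" for s
      by (simp add: \<phi>_def exp_minus)
    ultimately show ?thesis by simp
  qed
  then show "{t \<in> {0..}. \<not> continuous (at t within {0..}) (\<lambda>s. norm (min_subgrad (x s)))}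
      \<subseteq> {t \<in> {0..}. \<not> continuous (at t within {0..}) \<phi>}"
    by blast
qed

lemma limit_curve_solution:
  assumes x: "prox_limit_curve \<beta> x"
  shows "prox_flow_solution F (x 0) x"
  unfolding prox_flow_solution_def
proof (intro conjI allI impI)
  fix T :: real assume "0 \<le> T"
  then obtain C where "C > 0" and C: "\<And>s t. 0 \<le> s \<Longrightarrow> s \<le> t \<Longrightarrow> t \<le> T \<Longrightarrow> norm (x t - x s) \<le> C * (t - s)"
    using limit_curve_lipschitz[OF x] by metis
  show "absolutely_continuous_on {0..T} x"
    by (rule absolutely_continuous_on_dominated[OF absolutely_continuous_on_const[of _ "0::real"]
          absolutely_continuous_on_const[of _ "0::real"], of C]) (use \<open>C > 0\<close> C in auto)
next
  define N where "N = {t \<in> {0..}. \<not> continuous (at t within {0..}) (\<lambda>s. norm (min_subgrad (x s)))}"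
  have "N \<in> null_sets lebesgue"
    unfolding N_def
    by (rule null_sets_completionI[OF countable_imp_null_set_lborel[OF limit_curve_countable_discont[OF x]]])
  then have "N \<in> null_sets (lebesgue_on {0..})"
    by (subst null_sets_restrict_space) (auto simp: N_def)
  moreover have "{t \<in> space (lebesgue_on {0..}).
      \<not> (\<exists>v. (x has_vector_derivative v) (at t within {0..}) \<and> has_prox_velocity F (x t) v)} \<subseteq> N"
    using limit_curve_has_vector_derivative[OF x] by (auto simp: N_def has_prox_velocity_iff)
  ultimately show "AE t in lebesgue_on {0..}. \<exists>v. (x has_vector_derivative v) (at t within {0..}) \<and> has_prox_velocity F (x t) v"
    by (rule AE_I')
qed simp

text \<open>The piecewise constant curves built from proximal iterations with steps \<open>b n\<close> converge along a
diagonal subsequence at all rational times, and then at all times because they are Lipschitz up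
to an error of order \<open>b n\<close>.\<close>

lemma ex_limit_curve:
  obtains \<beta> x where "prox_limit_curve \<beta> x" "x 0 = x0"
proof -
  define b where "b n = 1 / (real n + 1 + 2 * L)" for n
  have b: "0 < b n" "b n * L \<le> 1 / 2" for n
    using L by (auto simp: b_def field_simps add_nonneg_pos)
  have b0: "b \<longlonglongrightarrow> 0" unfolding b_def by real_asymp
  define w where "w = min_subgrad x0"
  define k where "k n t = nat \<lfloor>t / b n\<rfloor>" for n t
  have k: "real (k n t) * b n \<le> t" "t < real (k n t) * b n + b n" if "0 \<le> t" for n t
  proof -
    have "real (k n t) \<le> t / b n" "t / b n < real (k n t) + 1"
      using that b(1)[of n] by (auto simp: k_def)
    then show "real (k n t) * b n \<le> t" "t < real (k n t) * b n + b n"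
      using b(1)[of n] by (auto simp: field_simps)
  qed
  have k_mono: "k n s \<le> k n t" if "s \<le> t" for n s t
    unfolding k_def using that b(1)[of n] by (intro nat_mono floor_mono divide_right_mono) auto
  define X where "X n t = (prox (b n) F ^^ k n t) x0" for n t
  have X_diff: "norm (X n t - X n s) \<le> (t - s + b n) * (exp (2 * L * t) * norm w)"
    if st: "0 \<le> s" "s \<le> t" for n s t
  proof -
    define d where "d = k n t - k n s"
    have kd: "k n t = k n s + d" using k_mono[OF st(2)] by (simp add: d_def)
    then have d: "real d * b n = real (k n t) * b n - real (k n s) * b n"
      by (simp add: algebra_simps)
    have "norm (X n t - X n s) \<le> exp (2 * L * (real (k n s) * b n)) * norm ((prox (b n) F ^^ d) x0 - x0)"
      unfolding X_def kd funpow_add o_def by (rule iterate_lipschitz[OF b])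
    also have "\<dots> \<le> exp (2 * L * (real (k n s) * b n)) * (real d * b n * exp (2 * L * (real d * b n)) * norm w)"
      unfolding w_def by (intro mult_left_mono iterate_displacement_le b min_subgrad_in) auto
    also have "\<dots> = real d * b n * (exp (2 * L * (real (k n s) * b n) + 2 * L * (real d * b n)) * norm w)"
      by (simp add: exp_add)
    also have "2 * L * (real (k n s) * b n) + 2 * L * (real d * b n) = 2 * L * (real (k n t) * b n)"
      unfolding d by (simp add: algebra_simps)
    also have "real d * b n * (exp (2 * L * (real (k n t) * b n)) * norm w) \<le> (t - s + b n) * (exp (2 * L * t) * norm w)"
    proof (intro mult_mono)
      show "real d * b n \<le> t - s + b n" using d k[of t n] k[of s n] st by linarith
      show "exp (2 * L * (real (k n t) * b n)) \<le> exp (2 * L * t)"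
        using k(1)[of t n] st L by (auto intro: mult_left_mono)
    qed (use st b(1)[of n] in auto)
    finally show ?thesis .
  qed
  have X0: "X n 0 = x0" for n by (simp add: X_def k_def)
  have b1: "b n \<le> 1" for n using L by (simp add: b_def field_simps)
  define M where "M t = norm x0 + (t + 1) * (exp (2 * L * t) * norm w) + 1" for t
  have M: "M t > 0" if "0 \<le> t" for t
    unfolding M_def using that by (intro add_nonneg_pos add_nonneg_nonneg mult_nonneg_nonneg) auto
  have XM: "norm (X n t) \<le> M t" if "0 \<le> t" for n t
  proof -
    have "norm (X n t - X n 0) \<le> (t - 0 + b n) * (exp (2 * L * t) * norm w)"
      using that by (intro X_diff) auto
    also have "\<dots> \<le> (t + 1) * (exp (2 * L * t) * norm w)"
      using b1[of n] by (intro mult_right_mono) auto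
    finally show ?thesis
      using norm_triangle_ineq2[of "X n t" x0] by (simp add: M_def X0)
  qed
  define S where "S = \<rat> \<inter> {0::real..}"
  have "countable S" unfolding S_def using countable_rat by (rule countable_Int1)
  \<comment> \<open>The selection principle wants a bound that is uniform in time; dividing by \<open>M t\<close> provides one.\<close>
  moreover have "norm ((1 / M t) *\<^sub>R X n t) \<le> 1" if "t \<in> S" for n t
    using that M[of t] XM[of t n] by (simp add: S_def pos_divide_le_eq)
  ultimately obtain r where r: "strict_mono (r::nat\<Rightarrow>nat)"
    and conv: "\<And>t. t \<in> S \<Longrightarrow> \<exists>l. (\<lambda>n. (1 / M t) *\<^sub>R X (r n) t) \<longlonglongrightarrow> l"
    using function_convergent_subsequence[of S "\<lambda>n t. (1 / M t) *\<^sub>R X n t" 1] by metis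
  have br0: "(\<lambda>n. b (r n)) \<longlonglongrightarrow> 0"
    using LIMSEQ_subseq_LIMSEQ[OF b0 r] by (simp add: o_def)
  have convS: "convergent (\<lambda>n. X (r n) t)" if "t \<in> S" for t
  proof -
    obtain l where "(\<lambda>n. (1 / M t) *\<^sub>R X (r n) t) \<longlonglongrightarrow> l" using conv[OF \<open>t \<in> S\<close>] by blast
    then have "(\<lambda>n. M t *\<^sub>R ((1 / M t) *\<^sub>R X (r n) t)) \<longlonglongrightarrow> M t *\<^sub>R l" by (intro tendsto_intros)
    then show ?thesis using M[of t] \<open>t \<in> S\<close> by (auto simp: S_def convergent_def)
  qed
  have "convergent (\<lambda>n. X (r n) t)" if t: "0 \<le> t" for t
  proof (rule Cauchy_convergent, rule metric_CauchyI)
    fix e :: real assume "0 < e"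
    define C where "C = exp (2 * L * (t + 1)) * norm w + 1"
    have "C > 0" by (simp add: C_def add_nonneg_pos)
    define \<eta> where "\<eta> = min 1 (e / (6 * C))"
    have \<eta>: "\<eta> > 0" "C * \<eta> \<le> e / 6"
    proof -
      show "\<eta> > 0" using \<open>0 < e\<close> \<open>C > 0\<close> by (simp add: \<eta>_def)
      have "C * \<eta> \<le> C * (e / (6 * C))" using \<open>C > 0\<close> by (intro mult_left_mono) (auto simp: \<eta>_def)
      then show "C * \<eta> \<le> e / 6" using \<open>C > 0\<close> by simp
    qed
    obtain q where q: "q \<in> \<rat>" "t < q" "q < t + \<eta>"
      using Rats_dense_in_real[of t "t + \<eta>"] \<open>\<eta> > 0\<close> by auto
    have "q \<in> S" "q \<le> t + 1" using q t by (auto simp: S_def \<eta>_def)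
    obtain N1 where N1: "\<And>m n. m \<ge> N1 \<Longrightarrow> n \<ge> N1 \<Longrightarrow> dist (X (r m) q) (X (r n) q) < e / 3"
      using convergent_Cauchy[OF convS[OF \<open>q \<in> S\<close>]] \<open>0 < e\<close> metric_CauchyD[of _ "e / 3"] by (metis zero_less_divide_iff zero_less_numeral)
    obtain N2 where N2: "\<And>n. n \<ge> N2 \<Longrightarrow> b (r n) < \<eta>"
      using order_tendstoD(2)[OF br0 \<open>\<eta> > 0\<close>] unfolding eventually_sequentially by blast
    have near: "norm (X (r n) q - X (r n) t) \<le> e / 3" if "n \<ge> N2" for n
    proof -
      have "norm (X (r n) q - X (r n) t) \<le> (q - t + b (r n)) * (exp (2 * L * q) * norm w)"
        using q t by (intro X_diff) auto
      also have "\<dots> \<le> (\<eta> + \<eta>) * C"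
      proof (intro mult_mono)
        show "q - t + b (r n) \<le> \<eta> + \<eta>" using q N2[OF that] by linarith
        have "exp (2 * L * q) * norm w \<le> exp (2 * L * (t + 1)) * norm w"
          using \<open>q \<le> t + 1\<close> L by (intro mult_right_mono) (auto intro: mult_left_mono)
        then show "exp (2 * L * q) * norm w \<le> C" by (simp add: C_def)
      qed (use \<open>\<eta> > 0\<close> in auto)
      also have "\<dots> \<le> e / 3" using \<eta> by (simp add: algebra_simps)
      finally show ?thesis .
    qed
    show "\<exists>N. \<forall>m\<ge>N. \<forall>n\<ge>N. dist (X (r m) t) (X (r n) t) < e"
    proof (intro exI allI impI)
      fix m n assume mn: "max N1 N2 \<le> m" "max N1 N2 \<le> n"
      have "dist (X (r m) t) (X (r n) t) \<le> dist (X (r m) t) (X (r m) q) + (dist (X (r m) q) (X (r n) q) + dist (X (r n) q) (X (r n) t))"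
        by (meson add_left_mono dist_triangle order_trans)
      moreover have "dist (X (r m) q) (X (r n) q) < e / 3" using mn by (intro N1) auto
      moreover have "dist (X (r m) t) (X (r m) q) \<le> e / 3" "dist (X (r n) q) (X (r n) t) \<le> e / 3"
        using near[of m] near[of n] mn by (auto simp: dist_norm norm_minus_commute)
      ultimately show "dist (X (r m) t) (X (r n) t) < e" by linarith
    qed
  qed
  then obtain x where x: "\<And>t. 0 \<le> t \<Longrightarrow> (\<lambda>n. X (r n) t) \<longlonglongrightarrow> x t"
    unfolding convergent_def by metis
  have kr: "(\<lambda>n. real (k (r n) t) * b (r n)) \<longlonglongrightarrow> t" if t: "0 \<le> t" for t
  proof (rule tendsto_sandwich)
    show "\<forall>\<^sub>F n in sequentially. t - b (r n) \<le> real (k (r n) t) * b (r n)"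
      using k(2)[OF t] by (intro always_eventually allI) (simp add: algebra_simps less_imp_le)
    show "\<forall>\<^sub>F n in sequentially. real (k (r n) t) * b (r n) \<le> t"
      using k(1)[OF t] by simp
    have "(\<lambda>n. t - b (r n)) \<longlonglongrightarrow> t - 0" by (intro tendsto_intros br0)
    then show "(\<lambda>n. t - b (r n)) \<longlonglongrightarrow> t" by simp
  qed simp
  have "prox_limit_curve (\<lambda>n. b (r n)) x"
    unfolding prox_limit_curve_def
  proof (intro conjI allI impI)
    fix s t :: real assume st: "0 \<le> s" "s \<le> t"
    define d where "d n = k (r n) t - k (r n) s" for n
    have kd: "k (r n) t = d n + k (r n) s" for n using k_mono[OF st(2)] by (simp add: d_def)
    have "(\<lambda>n. real (k (r n) t) * b (r n) - real (k (r n) s) * b (r n)) \<longlonglongrightarrow> t - s"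
      using st by (intro tendsto_diff kr) auto
    then have db: "(\<lambda>n. real (d n) * b (r n)) \<longlonglongrightarrow> t - s"
      unfolding kd by (simp add: algebra_simps)
    have lim: "(\<lambda>n. exp (2 * L * (real (d n) * b (r n))) * norm (x s - X (r n) s)) \<longlonglongrightarrow> exp (2 * L * (t - s)) * norm (x s - x s)"
      using st by (intro tendsto_intros db x)
    have le: "norm ((prox (b (r n)) F ^^ d n) (x s) - X (r n) t) \<le> exp (2 * L * (real (d n) * b (r n))) * norm (x s - X (r n) s)" for n
      unfolding X_def kd funpow_add o_def by (rule iterate_lipschitz[OF b])
    have "(\<lambda>n. (prox (b (r n)) F ^^ d n) (x s) - X (r n) t) \<longlonglongrightarrow> 0"
    proof (rule Lim_null_comparison[OF always_eventually])
      show "\<forall>n. norm ((prox (b (r n)) F ^^ d n) (x s) - X (r n) t)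
          \<le> exp (2 * L * (real (d n) * b (r n))) * norm (x s - X (r n) s)"
        using le by (rule allI)
      show "(\<lambda>n. exp (2 * L * (real (d n) * b (r n))) * norm (x s - X (r n) s)) \<longlonglongrightarrow> 0"
        using lim by (simp only: diff_self norm_zero mult_zero_right)
    qed
    then have "(\<lambda>n. ((prox (b (r n)) F ^^ d n) (x s) - X (r n) t) + X (r n) t) \<longlonglongrightarrow> 0 + x t"
      by (rule tendsto_add[OF _ x[OF order_trans[OF st]]])
    then have "(\<lambda>n. (prox (b (r n)) F ^^ d n) (x s)) \<longlonglongrightarrow> x t"
      by (simp only: diff_add_cancel add_0)
    then show "\<exists>k. (\<lambda>n. real (k n) * b (r n)) \<longlonglongrightarrow> t - s \<and> (\<lambda>n. (prox (b (r n)) F ^^ k n) (x s)) \<longlonglongrightarrow> x t"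
      using db by blast
  qed (use b br0 in auto)
  moreover have "x 0 = x0"
    using x[of 0] X0 by (simp add: LIMSEQ_const_iff)
  ultimately show ?thesis by (rule that)
qed

lemma solution_exists: "\<exists>x. prox_flow_solution F x0 x"
  using ex_limit_curve[of x0] limit_curve_solution by metis

end

section \<open>Uniqueness of solutions\<close>

context weakly_convex_function
begin

text \<open>Hypomonotonicity of the subdifferential makes \<open>exp (- 2 * L * t)\<close> times the squared distance of two
solutions nonincreasing.\<close>

lemma solution_unique:
  assumes x: "prox_flow_solution F x0 x" and y: "prox_flow_solution F x0 y" and T: "0 \<le> T"
  shows "x T = y T"
proof -
  define d where "d t = x t - y t" for t
  define g where "g t = exp (- (2 * L * t)) * (norm (d t))\<^sup>2" for t
  have acx: "absolutely_continuous_on {0..T} x" and acy: "absolutely_continuous_on {0..T} y"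
    using x y T unfolding prox_flow_solution_def by auto
  obtain B where B: "B \<ge> 0" "\<And>t. t \<in> {0..T} \<Longrightarrow> norm (d t) \<le> B"
  proof -
    have "continuous_on {0..T} d"
      unfolding d_def by (intro continuous_on_diff absolutely_continuous_on_imp_continuous_on acx acy)
    then have "bounded (d ` {0..T})"
      by (intro compact_imp_bounded compact_continuous_image) auto
    then obtain B where B: "\<And>t. t \<in> {0..T} \<Longrightarrow> norm (d t) \<le> B"
      unfolding bounded_iff by blast
    moreover have "B \<ge> 0" using order_trans[OF norm_ge_zero B[of 0]] T by simp
    ultimately show ?thesis using that by blast
  qed
  have "absolutely_continuous_on {0..T} g"
  proof (rule absolutely_continuous_on_dominated[OF acx acy])
    show "0 \<le> 2 * B + 2 * L * B\<^sup>2" using \<open>0 \<le> B\<close> L by simp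
    fix s t assume st: "s \<in> {0..T}" "t \<in> {0..T}" "s \<le> t"
    define E where "E r = exp (- (2 * L * r))" for r
    have E1: "0 < E t" "E t \<le> 1" "0 < E s" "E s \<le> 1" using st L by (auto simp: E_def)
    have E2: "\<bar>E t - E s\<bar> \<le> 2 * L * (t - s)"
    proof -
      have "E t \<le> E s" using st L by (auto simp: E_def intro: mult_left_mono)
      then have "\<bar>E t - E s\<bar> = E s - E t" by simp
      also have "\<dots> = E s * (1 - exp (- (2 * L * (t - s))))"
        by (simp add: E_def exp_add[symmetric] algebra_simps)
      also have "\<dots> \<le> 1 * (1 - exp (- (2 * L * (t - s))))"
        using st L E1 by (intro mult_right_mono) auto
      also have "\<dots> \<le> 2 * L * (t - s)"
      proof -
        have "1 - exp (- c) \<le> c" for c :: real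
          using exp_ge_add_one_self[of "- c"] by linarith
        then show ?thesis by (simp only: mult_1)
      qed
      finally show ?thesis .
    qed
    have dd: "\<bar>(norm (d t))\<^sup>2 - (norm (d s))\<^sup>2\<bar> \<le> 2 * B * (norm (x t - x s) + norm (y t - y s))"
    proof -
      have "\<bar>(norm (d t))\<^sup>2 - (norm (d s))\<^sup>2\<bar> = (norm (d t) + norm (d s)) * \<bar>norm (d t) - norm (d s)\<bar>"
        by (simp add: power2_eq_square square_diff_square_factored abs_mult)
      also have "\<dots> \<le> (B + B) * norm (d t - d s)"
        using B st by (intro mult_mono add_mono norm_triangle_ineq3) auto
      also have "norm (d t - d s) \<le> norm (x t - x s) + norm (y t - y s)"
        using norm_triangle_ineq4[of "x t - x s" "y t - y s"] by (simp add: d_def algebra_simps)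
      finally show ?thesis using \<open>0 \<le> B\<close> by (simp add: mult_left_mono)
    qed
    have "g t - g s = E t * ((norm (d t))\<^sup>2 - (norm (d s))\<^sup>2) + (E t - E s) * (norm (d s))\<^sup>2"
      by (simp add: g_def E_def algebra_simps)
    then have "\<bar>g t - g s\<bar> \<le> E t * \<bar>(norm (d t))\<^sup>2 - (norm (d s))\<^sup>2\<bar> + \<bar>E t - E s\<bar> * (norm (d s))\<^sup>2"
      using abs_triangle_ineq[of "E t * ((norm (d t))\<^sup>2 - (norm (d s))\<^sup>2)" "(E t - E s) * (norm (d s))\<^sup>2"] E1
      by (simp add: abs_mult)
    also have "\<dots> \<le> 1 * (2 * B * (norm (x t - x s) + norm (y t - y s))) + (2 * L * (t - s)) * B\<^sup>2"
      using E1 E2 dd B st L by (intro add_mono mult_mono power_mono) auto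
    also have "\<dots> \<le> (2 * B + 2 * L * B\<^sup>2) * (norm (x t - x s) + norm (y t - y s) + (t - s))"
    proof -
      have "0 \<le> 2 * B * (t - s) + 2 * L * B\<^sup>2 * (norm (x t - x s) + norm (y t - y s))"
        using B L st by simp
      then show ?thesis by (simp add: algebra_simps)
    qed
    finally show "norm (g t - g s) \<le> (2 * B + 2 * L * B\<^sup>2) * (norm (x t - x s) + norm (y t - y s) + (t - s))"
      by simp
  qed
  moreover obtain N where N: "negligible N"
    "\<And>t. t \<in> {0..T} - N \<Longrightarrow> (x has_vector_derivative - min_subgrad (x t)) (at t within {0..}) \<and>
        (y has_vector_derivative - min_subgrad (y t)) (at t within {0..})"
  proof -
    have "AE t in lebesgue_on {0..}. (x has_vector_derivative - min_subgrad (x t)) (at t within {0..}) \<and>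
        (y has_vector_derivative - min_subgrad (y t)) (at t within {0..})"
      using x y unfolding prox_flow_solution_def has_prox_velocity_iff by auto
    then obtain N where N: "N \<in> null_sets (lebesgue_on {0..})"
       "{t \<in> space (lebesgue_on {0..}). \<not> ((x has_vector_derivative - min_subgrad (x t)) (at t within {0..}) \<and>
        (y has_vector_derivative - min_subgrad (y t)) (at t within {0..}))} \<subseteq> N"
      unfolding eventually_ae_filter by blast
    have "negligible N"
      using N(1) by (subst (asm) null_sets_restrict_space) (auto simp: negligible_iff_null_sets)
    then show ?thesis using N(2) by (intro that[of N]) auto
  qed
  moreover have "\<exists>D\<le>0. (g has_vector_derivative D) (at t within {0..T})" if t: "t \<in> {0..T} - N" for t
  proof -
    define v where "v = min_subgrad (x t) - min_subgrad (y t)"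
    have "(x has_vector_derivative - min_subgrad (x t)) (at t within {0..T})"
      "(y has_vector_derivative - min_subgrad (y t)) (at t within {0..T})"
      using N(2)[OF t] by (auto intro: has_vector_derivative_within_subset)
    then have "(d has_vector_derivative - min_subgrad (x t) - - min_subgrad (y t)) (at t within {0..T})"
      unfolding d_def by (rule has_vector_derivative_diff)
    then have d: "(d has_derivative (\<lambda>h. h *\<^sub>R (- v))) (at t within {0..T})"
      by (simp add: has_vector_derivative_def v_def)
    have "((\<lambda>s. d s \<bullet> d s) has_derivative (\<lambda>h. d t \<bullet> (h *\<^sub>R (- v)) + (h *\<^sub>R (- v)) \<bullet> d t)) (at t within {0..T})"
      by (rule has_derivative_inner[OF d d])
    then have "((\<lambda>s. (norm (d s))\<^sup>2) has_vector_derivative - 2 * (v \<bullet> d t)) (at t within {0..T})"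
      unfolding has_vector_derivative_def power2_norm_eq_inner
      by (rule has_derivative_eq_rhs) (simp add: fun_eq_iff inner_commute)
    then have n: "((\<lambda>s. (norm (d s))\<^sup>2) has_field_derivative - 2 * (v \<bullet> d t)) (at t within {0..T})"
      by (simp add: has_real_derivative_iff_has_vector_derivative)
    have e: "((\<lambda>s. exp (- (2 * L * s))) has_field_derivative - 2 * L * exp (- (2 * L * t))) (at t within {0..T})"
      by (auto intro!: derivative_eq_intros)
    have "(g has_field_derivative - 2 * L * exp (- (2 * L * t)) * (norm (d t))\<^sup>2 + - 2 * (v \<bullet> d t) * exp (- (2 * L * t))) (at t within {0..T})"
      unfolding g_def using DERIV_mult[OF e n] by simp
    moreover have "- 2 * L * exp (- (2 * L * t)) * (norm (d t))\<^sup>2 + - 2 * (v \<bullet> d t) * exp (- (2 * L * t))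
       = (- 2 * exp (- (2 * L * t))) * (L * (norm (d t))\<^sup>2 + v \<bullet> d t)"
      by (simp add: algebra_simps)
    moreover have "0 \<le> L * (norm (d t))\<^sup>2 + v \<bullet> d t"
      using subdiff_hypomonotone[OF min_subgrad_in[of "x t"] min_subgrad_in[of "y t"]] by (simp add: v_def d_def)
    then have "(- 2 * exp (- (2 * L * t))) * (L * (norm (d t))\<^sup>2 + v \<bullet> d t) \<le> 0"
      by (intro mult_nonpos_nonneg) auto
    ultimately show ?thesis
      by (metis has_real_derivative_iff_has_vector_derivative)
  qed
  ultimately have "g T \<le> g 0"
    using T by (intro absolutely_continuous_on_nonincreasing[of 0 T g N]) auto
  also have "g 0 = 0" using x y by (simp add: g_def d_def prox_flow_solution_def)
  finally have "(norm (d T))\<^sup>2 \<le> 0" by (simp add: g_def mult_le_0_iff)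
  then show ?thesis by (simp add: d_def)
qed

end

theorem theorem2p4:
  fixes f h F :: "real ^ 'n \<Rightarrow> real" and L :: real and x0 :: "real ^ 'n"
  assumes "L_smooth L f"
    and "convex_on UNIV h"
    and "F = (\<lambda>x. f x + h x)"
  shows "(\<exists>x. prox_flow_solution F x0 x) \<and>
         (\<forall>x y. prox_flow_solution F x0 x \<and> prox_flow_solution F x0 y \<longrightarrow> (\<forall>t\<ge>0. x t = y t))"
proof -
  have "convex_on UNIV (\<lambda>x. (f x + L / 2 * (norm x)\<^sup>2) + h x)"
    using L_smooth_imp_weakly_convex[OF assms(1)] assms(2)
    unfolding weakly_convex_def by (rule convex_on_add)
  then have "weakly_convex L F"
    unfolding weakly_convex_def assms(3) by (simp add: algebra_simps)
  \<comment> \<open>The modulus \<open>max L 0\<close> also covers a negative \<open>L\<close>.\<close>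
  then have "weakly_convex (max L 0) F"
    by (rule weakly_convex_mono) simp
  then interpret weakly_convex_function F "max L 0"
    by unfold_locales (simp_all add: le_max_iff_disj)
  show ?thesis
    using solution_exists solution_unique by blast
qed

end
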